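(* Let $r\in(0,1]$, $t>0$, $a\ge 0$, and define for $x\in\mathbb{R}$ \[ S(x;r,t,a)=4ax^3-\{8a^2+4a(3r+2)t-t^2\}x^2+2\big[2a^3-2a^2(5r-2)t+a\{r(6r-1)+1\}t^2-(r+1)t^3\big]x+(r-1)^2t^2\{a^2-a(4r-2)t+t^2\}. \] Consider the case in which the cubic equation $S(x;r,t,a)=0$ in $x$ has three real solutions $x_1\le x_2\le x_3$, and set $x_{\rm L}(r,t,a):=x_2$, $x_{\rm R}(r,t,a):=x_3$. Put \[ g(x;r,t,a)=-2x^3+3\{(2r+1)t+6a\}x^2-3\Big[(r-1)\{(2r+1)t-3a\}t-\sqrt{-3S(x;r,t,a)}\Big]x+2(r-1)^3t^3, \] \[ \varphi(x;r,t,a)=-\frac{2}{3}\{x-(r-1)t\}-\frac{2^{1/3}}{3}\,\frac{x^2+\{3a-(2r+1)t\}x+t^2(r-1)^2}{g^{1/3}}-\frac{g^{1/3}}{3\cdot 2^{1/3}}, \] with $g=g(x;r,t,a)$, and with $\varphi=\varphi(x;r,t,a)$ put \[ d_-=t-a-2\sqrt{a\varphi},\quad d_+=t-a+2\sqrt{a\varphi},\quad d_0=\varphi+x+\frac{t-a}{2}+\frac12\sqrt{d_-d_+}, \] \[ f_{\rm L}(x;r,t,a)=\Big(\frac{\sqrt{d_-}+\sqrt{d_+}}{2}-\sqrt{d_0}\Big)^2,\qquad f_{\rm R}(x;r,t,a)=\Big(\frac{\sqrt{d_-}+\sqrt{d_+}}{2}+\sqrt{d_0}\Big)^2. \] Then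 the three-parametric Marcenko--Pastur density is given by \[ \rho(x;r,t,a)=\frac{\sqrt{(x-f_{\rm L}(x;r,t,a))(f_{\rm R}(x;r,t,a)-x)}}{2\pi r x t}\,\mathbf{1}_{(x_{\rm L}(r,t,a),\,x_{\rm R}(r,t,a))}(x), \] where $\mathbf 1_\Lambda$ denotes the indicator function of $\Lambda$.
   Context: Three-parametric Marcenko--Pastur (MP) density. Let $M\ge N$ be positive integers, $\nu=M-N$, and let $(X^N_j(t))_{j=1}^N$, $t\ge0$, solve the SDE system (Wishart / noncolliding squared Bessel process) $dX^N_j=2\sqrt{X^N_j}\,dB_j+2(\nu+1)\,dt+4X^N_j\sum_{k\ne j}\frac{dt}{X^N_j-X^N_k}$, with $B_j$ independent standard Brownian motions, started from $X^N_j(0)=aM$ for all $j$ (i.e. the scaled initial empirical measure is $\delta_a$). In the limit $N,M\to\infty$ with $N/M\to r\in(0,1]$, the empirical measure $\frac1N\sum_j\delta_{X^N_j(t)/M}(dx)$ converges weakly to a deterministic measure $\rho(x;r,t,a)\,dx$ on $[0,\infty)$; this density $\rho(x;r,t,a)$ is called the three-parametric MP density. Equivalently, its Stieltjes transform $G(z)=\int\frac{\rho(x;r,t,a)}{z-x}dx$, $z\in\mathbb{C}\setminus\mathbb{R}$, is the solution of $z=\frac1G+\frac{t}{1-rtG}+\frac{a}{(1-rtG)^2}$ (the branch reducing continuously as $a\to0$ to the one for $a=0$), and $\rho(x)=-\frac1\pi\lim_{\varepsilon\to0}\Im G(x+i\varepsilon)$. It is also the limiting eigenvalue density of $K^\dagger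 K/M$ where $K$ is $M\times N$ complex with independent entries, $\Re K_{kk}\sim N(\sqrt{Ma},t/2)$, all other $\Re K_{jk}\sim N(0,t/2)$, $\Im K_{jk}\sim N(0,t/2)$. *)

theory Defs
  imports "HOL-Probability.Probability"
begin

definition MP_S :: "real \<Rightarrow> real \<Rightarrow> real \<Rightarrow> real \<Rightarrow> real" where
  "MP_S r t a x =
     4*a*x^3 - (8*a^2 + 4*a*(3*r+2)*t - t^2)*x^2
     + 2*(2*a^3 - 2*a^2*(5*r-2)*t + a*(r*(6*r-1)+1)*t^2 - (r+1)*t^3)*x
     + (r-1)^2*t^2*(a^2 - a*(4*r-2)*t + t^2)"

definition MP_g :: "real \<Rightarrow> real \<Rightarrow> real \<Rightarrow> real \<Rightarrow> complex" where
  "MP_g r t a x =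
     complex_of_real (-2*x^3 + 3*((2*r+1)*t + 6*a)*x^2 - 3*(r-1)*((2*r+1)*t - 3*a)*t*x
                      + 2*(r-1)^3*t^3)
     + 3 * complex_of_real x * csqrt (complex_of_real (-3 * MP_S r t a x))"

definition ccbrt :: "complex \<Rightarrow> complex" where
  "ccbrt z = z powr (1/3)"

definition MP_phi :: "real \<Rightarrow> real \<Rightarrow> real \<Rightarrow> real \<Rightarrow> complex" where
  "MP_phi r t a x =
     (let g3 = ccbrt (MP_g r t a x); c = complex_of_real (root 3 2) in
      complex_of_real (-(2/3)*(x - (r-1)*t))
      - (c/3) * complex_of_real (x^2 + (3*a - (2*r+1)*t)*x + t^2*(r-1)^2) / g3
      - g3 / (3*c))"

definition MP_dm :: "real \<Rightarrow> real \<Rightarrow> real \<Rightarrow> real \<Rightarrow> complex" where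
  "MP_dm r t a x = complex_of_real (t - a) - 2 * csqrt (complex_of_real a * MP_phi r t a x)"

definition MP_dp :: "real \<Rightarrow> real \<Rightarrow> real \<Rightarrow> real \<Rightarrow> complex" where
  "MP_dp r t a x = complex_of_real (t - a) + 2 * csqrt (complex_of_real a * MP_phi r t a x)"

definition MP_d0 :: "real \<Rightarrow> real \<Rightarrow> real \<Rightarrow> real \<Rightarrow> complex" where
  "MP_d0 r t a x = MP_phi r t a x + complex_of_real (x + (t - a)/2)
                   + csqrt (MP_dm r t a x * MP_dp r t a x) / 2"

definition MP_fL :: "real \<Rightarrow> real \<Rightarrow> real \<Rightarrow> real \<Rightarrow> complex" where
  "MP_fL r t a x = ((csqrt (MP_dm r t a x) + csqrt (MP_dp r t a x))/2 - csqrt (MP_d0 r t a x))^2"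

definition MP_fR :: "real \<Rightarrow> real \<Rightarrow> real \<Rightarrow> real \<Rightarrow> complex" where
  "MP_fR r t a x = ((csqrt (MP_dm r t a x) + csqrt (MP_dp r t a x))/2 + csqrt (MP_d0 r t a x))^2"

definition MP_formula :: "real \<Rightarrow> real \<Rightarrow> real \<Rightarrow> real \<Rightarrow> complex" where
  "MP_formula r t a x =
     csqrt ((complex_of_real x - MP_fL r t a x) * (MP_fR r t a x - complex_of_real x))
     / complex_of_real (2*pi*r*x*t)"

definition stieltjes :: "real measure \<Rightarrow> complex \<Rightarrow> complex" where
  "stieltjes \<mu> z = integral\<^sup>L \<mu> (\<lambda>x. 1 / (z - complex_of_real x))"

definition is_MP_measure :: "real \<Rightarrow> real \<Rightarrow> real \<Rightarrow> real measure \<Rightarrow> bool" where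
  "is_MP_measure r t a \<mu> \<longleftrightarrow>
     prob_space \<mu> \<and> sets \<mu> = sets borel \<and> emeasure \<mu> {..<0} = 0 \<and>
     (\<forall>z. Im z \<noteq> 0 \<longrightarrow>
        (let G = stieltjes \<mu> z; w = 1 - complex_of_real (r*t) * G in
         z = 1/G + complex_of_real t / w + complex_of_real a / w^2))"

end

theory Submission
  imports Defs "HOL-Complex_Analysis.Complex_Analysis" "HOL-Real_Asymp.Real_Asymp"
begin

text \<open>
  Put k = rt, b = t - k, w = 1 - k G. The defining equation says that w is a fixed point of
  T(w) = 1 - k / (zw - b - a/w). For z in the upper half plane, T maps the convex cone
  {Im w > 0, Im (zw) > 0} into itself, so Brouwer's theorem gives a fixed point there. Taking
  imaginary parts of the equations for w and zw yields k |G|^2 (|z| + a/|w|^2) < 1, which makes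
  the fixed point unique and holomorphic in z and bounds |G| by (k |z|)^(-1/2). The Stieltjes
  transform of any solution lies in the cone, so uniqueness of the measure is injectivity of the
  Stieltjes transform. Conversely the bound on G gives an integrable majorant of Im G on
  horizontal lines, so Cauchy's formula on large rectangles and dominated convergence
  reconstruct G from its boundary values. At real x the equation is a real cubic in w whose
  discriminant is a positive multiple of S(x); where S(x) < 0 < x, the boundary value of w is
  its root in the upper half plane, and Cardano's formula turns Im w into the closed form.
\<close>

section \<open>Stieltjes transforms and boundary values\<close>

text \<open>The defining equation displays no branch, so existence of a measure solving it is as
  much part of the claim as the form of its density. The branch is pinned by two signs on the upper
  half plane, those of Im G and Im (z G); the second records that the measure lives on the positive
  half line. Im w and Im (z w) obey a linear system with nonnegative coefficients, and uniqueness,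
  differentiability and the bound on G all rest on its spectral radius being below 1. In the
  reconstruction G itself decays only like 1/z, which is not integrable along a line. Im G decays
  like x^(-2), because G - 1/z does and Im (1/z) is small there; hence only Im G is integrated. For
  x > 0 the real cubic always has a negative root, and when S(x) < 0 it must be excluded that the
  boundary value is this root. The case a = 0 cannot occur: S would be quadratic with leading
  coefficient t^2, while the assumed factorization would vanish identically. The ordered roots
  satisfy x1 <= 0 <= x2, so (x2, x3) is the only part of the positive axis where S < 0.\<close>

lemma Im_stieltjes:
  assumes "real_distribution M" and h: "0 < h"
  shows "Im (stieltjes M (Complex x h)) = - (LINT y|M. h / ((x - y)\<^sup>2 + h\<^sup>2))"
    and "integrable M (\<lambda>y. 1 / (Complex x h - of_real y))"
proof -
  interpret real_distribution M by fact
  have b: "h \<le> cmod (Complex x h - of_real y)" for y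
    using abs_Im_le_cmod[of "Complex x h - of_real y"] h by simp
  show int: "integrable M (\<lambda>y. 1 / (Complex x h - of_real y))"
    by (rule integrable_const_bound[where B="1/h"])
      (use h b in \<open>auto simp: norm_divide intro!: frac_le\<close>)
  have "Im (stieltjes M (Complex x h)) = (LINT y|M. Im (1 / (Complex x h - of_real y)))"
    unfolding stieltjes_def using integral_Im[OF int] by simp
  also have "\<dots> = (LINT y|M. - (h / ((x - y)\<^sup>2 + h\<^sup>2)))"
    by (rule Bochner_Integration.integral_cong) (auto simp: Im_divide)
  finally show "Im (stieltjes M (Complex x h)) = - (LINT y|M. h / ((x - y)\<^sup>2 + h\<^sup>2))" by simp
qed

text \<open>Fubini for the Poisson kernel, whose antiderivative in x is an arctangent. The left side
  is a smoothed form of pi times the mass of [c, d], with smoothing scale h.\<close>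

lemma arctan_stieltjes:
  assumes "real_distribution M" and h: "0 < h" and cd: "c \<le> d"
  shows "(LINT y|M. arctan ((d - y) / h) - arctan ((c - y) / h)) =
    (LBINT x. - Im (stieltjes M (Complex x h)) * indicator {c..d} x)"
proof -
  interpret M: real_distribution M by fact
  interpret P: pair_sigma_finite lborel M ..
  define f where "f x y = h / ((x - y)\<^sup>2 + h\<^sup>2) * indicator {c..d} x" for x y :: real
  have pos: "0 < (x - y)\<^sup>2 + h\<^sup>2" for x y using h by (simp add: add_nonneg_pos)
  have "integrable (lborel \<Otimes>\<^sub>M M) (case_prod f)"
  proof (rule integrableI_bounded_set[where B="1/h" and A="{c..d} \<times> space M"])
    show "emeasure (lborel \<Otimes>\<^sub>M M) ({c..d} \<times> space M) < \<infinity>"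
      using cd by (subst M.emeasure_pair_measure_Times) (auto simp: ennreal_mult_less_top M.emeasure_eq_measure)
    show "AE z\<in>{c..d} \<times> space M in lborel \<Otimes>\<^sub>M M. norm (case_prod f z) \<le> 1 / h"
    proof (rule AE_I2, clarify)
      fix x y :: real
      have "h / ((x - y)\<^sup>2 + h\<^sup>2) \<le> h / h\<^sup>2" using h by (intro divide_left_mono) (auto intro!: mult_pos_pos pos)
      then show "norm (f x y) \<le> 1 / h"
        using h pos[of x y] by (auto simp: f_def indicator_def power2_eq_square)
    qed
  qed (auto simp: f_def split_beta')
  from P.Fubini_integral[OF this]
  have "(\<integral>y. (\<integral>x. f x y \<partial>lborel) \<partial>M) = (\<integral>x. (\<integral>y. f x y \<partial>M) \<partial>lborel)" .
  moreover have "(LBINT x. f x y) = arctan ((d - y) / h) - arctan ((c - y) / h)" for y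
    unfolding f_def
  proof (rule integral_FTC_Icc_real[OF cd])
    fix x
    have "1 + ((x - y) / h)\<^sup>2 = ((x - y)\<^sup>2 + h\<^sup>2) / h\<^sup>2" using h by (simp add: field_simps)
    moreover have "1 / h / (n / h\<^sup>2) = h / n" if "0 < n" for n using h that by (simp add: field_simps power2_eq_square)
    ultimately have e: "1 / h / (1 + ((x - y) / h)\<^sup>2) = h / ((x - y)\<^sup>2 + h\<^sup>2)" using pos[of x y] by simp
    show "((\<lambda>x. arctan ((x - y) / h)) has_real_derivative h / ((x - y)\<^sup>2 + h\<^sup>2)) (at x)"
      unfolding e[symmetric] by (auto intro!: derivative_eq_intros simp: divide_inverse mult_ac)
    show "isCont (\<lambda>x. h / ((x - y)\<^sup>2 + h\<^sup>2)) x"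
      using pos[of x y] by (intro continuous_intros) auto
  qed
  moreover have "(LINT y|M. f x y) = - Im (stieltjes M (Complex x h)) * indicator {c..d} x" for x
    unfolding f_def Im_stieltjes(1)[OF assms(1) h] by (cases "x \<in> {c..d}") simp_all
  ultimately show ?thesis by simp
qed

text \<open>As h tends to 0 the smoothed mass converges boundedly to one in which atoms at the
  endpoints count half. Moving the endpoints afterwards removes these halves and leaves the
  cdf.\<close>

lemma stieltjes_injective:
  assumes M: "real_distribution M" and N: "real_distribution N"
    and eq: "\<And>z. 0 < Im z \<Longrightarrow> stieltjes M z = stieltjes N z"
  shows "M = N"
proof (rule cdf_unique[OF M N], rule ext)
  fix d :: real
  have fl: "filterlim (\<lambda>n. 1 / real (Suc n)) (at_right 0) sequentially"
    unfolding filterlim_at by (auto intro!: LIMSEQ_Suc[OF lim_1_over_n] simp del: of_nat_Suc)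
  have bnd: "\<bar>arctan u - arctan v\<bar> \<le> pi" for u v
    using arctan_bounded[of u] arctan_bounded[of v] by (auto simp: abs_le_iff)
  have sgn_lim: "(\<lambda>n. arctan (s / (1 / real (Suc n)))) \<longlonglongrightarrow> pi / 2 * sgn s" for s
    by (cases s "0::real" rule: linorder_cases) (simp_all, real_asymp+)
  have int: "integrable Q (\<lambda>y. sgn (u - y) - sgn (v - y))" if "real_distribution Q" for Q u v
  proof -
    interpret real_distribution Q by fact
    show ?thesis by (rule integrable_const_bound[where B=2]) (auto simp: sgn_if)
  qed
  have 1: "(\<lambda>n. LINT y|Q. arctan ((v - y) / (1 / real (Suc n))) - arctan ((u - y) / (1 / real (Suc n))))
      \<longlonglongrightarrow> (LINT y|Q. pi / 2 * sgn (v - y) - pi / 2 * sgn (u - y))"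
    if "real_distribution Q" for Q u v
  proof -
    interpret real_distribution Q by fact
    show ?thesis
    proof (rule integral_dominated_convergence[where w="\<lambda>_. pi"])
      show "AE y in Q. (\<lambda>n. arctan ((v - y) / (1 / real (Suc n))) - arctan ((u - y) / (1 / real (Suc n))))
          \<longlonglongrightarrow> pi / 2 * sgn (v - y) - pi / 2 * sgn (u - y)"
        by (intro AE_I2 tendsto_diff sgn_lim)
    qed (auto intro!: bnd simp del: of_nat_Suc)
  qed
  have 2: "(LINT y|M. pi / 2 * sgn (v - y) - pi / 2 * sgn (u - y)) = (LINT y|N. pi / 2 * sgn (v - y) - pi / 2 * sgn (u - y))"
    if "u \<le> v" for u v
  proof (rule LIMSEQ_unique[OF 1[OF M]])
    have eqh: "(LINT y|M. arctan ((v - y) / h) - arctan ((u - y) / h)) = (LINT y|N. arctan ((v - y) / h) - arctan ((u - y) / h))"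
      if "0 < h" for h
      unfolding arctan_stieltjes[OF M that \<open>u \<le> v\<close>] arctan_stieltjes[OF N that \<open>u \<le> v\<close>]
      using eq[of "Complex _ h"] that by simp
    then have "(\<lambda>n. LINT y|M. arctan ((v - y) / (1 / real (Suc n))) - arctan ((u - y) / (1 / real (Suc n)))) =
      (\<lambda>n. LINT y|N. arctan ((v - y) / (1 / real (Suc n))) - arctan ((u - y) / (1 / real (Suc n))))"
      by (intro ext eqh) simp
    then show "(\<lambda>n. LINT y|M. arctan ((v - y) / (1 / real (Suc n))) - arctan ((u - y) / (1 / real (Suc n))))
      \<longlonglongrightarrow> (LINT y|N. pi / 2 * sgn (v - y) - pi / 2 * sgn (u - y))"
      using 1[OF N] by simp
  qed
  \<comment> \<open>The right end approaches d strictly from above, so an atom at d gets full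
    weight; the left end eventually passes below every y.\<close>
  define s where "s n y = pi / 2 * sgn (d + 1 / real (Suc n) - y) - pi / 2 * sgn (- real n - y)" for n y
  have 3: "(\<lambda>n. LINT y|Q. s n y) \<longlonglongrightarrow> pi * cdf Q d" if "real_distribution Q" for Q
  proof -
    interpret real_distribution Q by fact
    have "(\<lambda>n. LINT y|Q. s n y) \<longlonglongrightarrow> (LINT y|Q. pi * indicator {..d} y)"
    proof (rule integral_dominated_convergence[where w="\<lambda>_. pi"])
      show "AE y in Q. (\<lambda>n. s n y) \<longlonglongrightarrow> pi * indicator {..d} y"
      proof (rule AE_I2)
        fix y
        obtain m where m: "\<bar>y\<bar> < real m" using reals_Archimedean2 by blast
        have "\<forall>\<^sub>F n in sequentially. 1 / real (Suc n) < (if y \<le> d then 1 else y - d)"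
          using order_tendstoD(2)[OF LIMSEQ_Suc[OF lim_1_over_n], of "if y \<le> d then 1 else y - d"] by (cases "y \<le> d") (auto simp del: of_nat_Suc)
        then have "\<forall>\<^sub>F n in sequentially. s n y = pi * indicator {..d} y"
          using eventually_ge_at_top[of m]
        proof eventually_elim
          case (elim n)
          have lo: "sgn (- real n - y) = -1"
          proof -
            have "- real n < y" using m elim(2) by (simp add: abs_less_iff)
            then show ?thesis by (simp add: sgn_if)
          qed
          have hi: "sgn (d + 1 / real (Suc n) - y) = (if y \<le> d then 1 else -1)"
          proof -
            define P where "P = 1 / real (Suc n)"
            have "0 < P" "P < (if y \<le> d then 1 else y - d)" using elim(1) by (simp_all add: P_def)
            then show ?thesis unfolding P_def[symmetric] by (auto simp: sgn_if split: if_splits)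
          qed
          show ?case unfolding s_def lo hi by (simp add: indicator_def)
        qed
        then show "(\<lambda>n. s n y) \<longlonglongrightarrow> pi * indicator {..d} y" by (rule tendsto_eventually)
      qed
      show "AE y in Q. norm (s n y) \<le> pi" for n
      proof -
        have "- (pi / 2) \<le> pi" using pi_gt_zero by linarith
        then show ?thesis by (auto simp: s_def sgn_if abs_le_iff)
      qed
    qed (auto simp: s_def)
    then show ?thesis by (simp add: cdf_def)
  qed
  obtain m where m: "\<bar>d\<bar> \<le> real m" using real_arch_simple by blast
  have "\<forall>\<^sub>F n in sequentially. (LINT y|M. s n y) = (LINT y|N. s n y)"
    using eventually_ge_at_top[of m]
  proof eventually_elim
    case (elim n)
    have "- real n \<le> d + 1 / real (Suc n)" using m elim by (simp add: add_increasing2 abs_le_iff)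
    then show ?case unfolding s_def by (rule 2)
  qed
  then have "(\<lambda>n. LINT y|N. s n y) \<longlonglongrightarrow> pi * cdf M d" by (rule Lim_transform_eventually[OF 3[OF M]])
  then have "pi * cdf M d = pi * cdf N d" using 3[OF N] by (rule LIMSEQ_unique)
  then show "cdf M d = cdf N d" by simp
qed

text \<open>On the three other sides |f| <= C/R and |\<zeta> - w| >= R/2, so the integrand is at
  most 2C/R^2 over a total length 4R. \<open>w\<close> may lie on either side of the real axis
  because it will be both z and \<open>cnj z\<close>.\<close>

lemma rectangle_bottom_estimate:
  fixes f :: "complex \<Rightarrow> complex"
  assumes hol: "f holomorphic_on {\<zeta>. - h < Im \<zeta>}" and h: "0 < h" and R: "0 < R"
    and decay: "\<And>\<zeta>. 0 \<le> Im \<zeta> \<Longrightarrow> R \<le> cmod \<zeta> \<Longrightarrow> cmod (f \<zeta>) \<le> C / R"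
    and w: "Im w \<noteq> 0" "cmod w \<le> R / 2"
  defines "K \<equiv> \<lambda>\<zeta>. f \<zeta> / (\<zeta> - w)"
  shows "cmod (integral {-R..R} (\<lambda>x. K (of_real x))
           - contour_integral (rectpath (- of_real R) (Complex R R)) K) \<le> 8 * C / R"
proof -
  define p1 p2 p3 p4 where p: "p1 = complex_of_real (- R)" "p2 = complex_of_real R" "p3 = Complex R R" "p4 = Complex (- R) R"
  have C: "0 \<le> C"
    using order_trans[OF norm_ge_zero decay[of "\<i> * of_real R"]] R by (simp add: zero_le_divide_iff norm_mult)
  have wR: "\<bar>Im w\<bar> \<le> R / 2" "\<bar>Re w\<bar> \<le> R / 2"
    using w abs_Im_le_cmod[of w] abs_Re_le_cmod[of w] by auto
  have sides: "closed_segment p1 p2 = {\<zeta>. Im \<zeta> = 0 \<and> \<bar>Re \<zeta>\<bar> \<le> R}"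
    "closed_segment p2 p3 = {\<zeta>. Re \<zeta> = R \<and> 0 \<le> Im \<zeta> \<and> Im \<zeta> \<le> R}"
    "closed_segment p3 p4 = {\<zeta>. Im \<zeta> = R \<and> \<bar>Re \<zeta>\<bar> \<le> R}"
    "closed_segment p4 p1 = {\<zeta>. Re \<zeta> = - R \<and> 0 \<le> Im \<zeta> \<and> Im \<zeta> \<le> R}"
    using R by (auto simp: p closed_segment_same_Im closed_segment_same_Re closed_segment_eq_real_ivl)
  have upper: "closed_segment p1 p2 \<union> closed_segment p2 p3 \<union> closed_segment p3 p4 \<union> closed_segment p4 p1
      \<subseteq> {\<zeta>. - h < Im \<zeta>} - {w}"
    unfolding sides using w wR R h by auto
  have holK: "K holomorphic_on {\<zeta>. - h < Im \<zeta>} - {w}"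
    unfolding K_def by (intro holomorphic_intros holomorphic_on_subset[OF hol]) auto
  have int: "K contour_integrable_on linepath p1 p2" "K contour_integrable_on linepath p2 p3"
    "K contour_integrable_on linepath p3 p4" "K contour_integrable_on linepath p4 p1"
    by (intro contour_integrable_continuous_linepath holomorphic_on_imp_continuous_on
        holomorphic_on_subset[OF holK] subset_trans[OF _ upper]; blast)+
  have rect: "rectpath (- of_real R) (Complex R R) = linepath p1 p2 +++ linepath p2 p3 +++ linepath p3 p4 +++ linepath p4 p1"
  proof -
    have "Complex R 0 = of_real R" "Complex (- R) 0 = of_real (- R)" by (simp_all add: complex_eq_iff)
    then show ?thesis by (simp add: rectpath_def Let_def p)
  qed
  have sum: "contour_integral (rectpath (- of_real R) (Complex R R)) K =
      contour_integral (linepath p1 p2) K + (contour_integral (linepath p2 p3) K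
      + (contour_integral (linepath p3 p4) K + contour_integral (linepath p4 p1) K))"
    unfolding rect by (simp add: int contour_integrable_joinI)
  have bottom: "contour_integral (linepath p1 p2) K = integral {-R..R} (\<lambda>x. K (of_real x))"
    using R by (subst contour_integral_linepath_Reals_eq) (auto simp: p)
  have K: "cmod (K \<zeta>) \<le> C / R * (2 / R)" if "0 \<le> Im \<zeta>" "R \<le> cmod \<zeta>" for \<zeta>
  proof -
    have "R / 2 \<le> cmod (\<zeta> - w)" using norm_triangle_ineq2[of \<zeta> w] that w by linarith
    then have "1 / cmod (\<zeta> - w) \<le> 1 / (R / 2)" using R by (intro frac_le) auto
    then have "1 / cmod (\<zeta> - w) \<le> 2 / R" by simp
    then have "cmod (f \<zeta>) * (1 / cmod (\<zeta> - w)) \<le> C / R * (2 / R)"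
      using decay[OF that] R C by (intro mult_mono) auto
    then show ?thesis by (simp add: K_def norm_divide)
  qed
  have bd: "cmod (contour_integral (linepath p q) K) \<le> C / R * (2 / R) * cmod (q - p)"
    if "K contour_integrable_on linepath p q" "\<And>\<zeta>. \<zeta> \<in> closed_segment p q \<Longrightarrow> 0 \<le> Im \<zeta> \<and> R \<le> cmod \<zeta>" for p q
    using that K R C by (intro contour_integral_bound_linepath) auto
  have 2: "cmod (contour_integral (linepath p2 p3) K) \<le> C / R * (2 / R) * R"
    using bd[OF int(2)] abs_Re_le_cmod R unfolding sides by (fastforce simp: p complex_of_real_def complex_diff cmod_def)
  have 3: "cmod (contour_integral (linepath p3 p4) K) \<le> C / R * (2 / R) * (2 * R)"
  proof -
    have "p4 - p3 = of_real (- 2 * R)" by (simp add: p complex_eq_iff)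
    then have "cmod (p4 - p3) = 2 * R" using R by (simp only: norm_of_real)
    moreover have "0 \<le> Im \<zeta> \<and> R \<le> cmod \<zeta>" if "\<zeta> \<in> closed_segment p3 p4" for \<zeta>
      using that abs_Im_le_cmod[of \<zeta>] R unfolding sides by simp
    ultimately show ?thesis using bd[OF int(3)] by simp
  qed
  have 4: "cmod (contour_integral (linepath p4 p1) K) \<le> C / R * (2 / R) * R"
    using bd[OF int(4)] abs_Re_le_cmod R unfolding sides by (fastforce simp: p complex_of_real_def complex_diff cmod_def)
  have "cmod (contour_integral (linepath p2 p3) K + (contour_integral (linepath p3 p4) K + contour_integral (linepath p4 p1) K))
     \<le> C / R * (2 / R) * R + (C / R * (2 / R) * (2 * R) + C / R * (2 / R) * R)"
    using 2 3 4 by (intro order_trans[OF norm_triangle_ineq] add_mono) auto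
  also have "\<dots> = 8 * C / R" using R by (simp add: field_simps)
  finally show ?thesis unfolding sum bottom
    by (simp only: norm_minus_commute[of _ "_ + _"] add_diff_cancel_left')
qed

text \<open>Cauchy's formula at z gives 2 pi i f(z), while the pole \<open>cnj z\<close> lies
  outside the rectangle and gives 0. Subtracting the conjugate of the second integral replaces f by
  2 i Im f on the real axis.\<close>

lemma half_plane_poisson_estimate:
  fixes f :: "complex \<Rightarrow> complex"
  assumes hol: "f holomorphic_on {\<zeta>. - h < Im \<zeta>}" and h: "0 < h" and R: "0 < R"
    and decay: "\<And>\<zeta>. 0 \<le> Im \<zeta> \<Longrightarrow> R \<le> cmod \<zeta> \<Longrightarrow> cmod (f \<zeta>) \<le> C / R"
    and z: "0 < Im z" "cmod z \<le> R / 2"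
  shows "cmod (integral {-R..R} (\<lambda>x. of_real (Im (f (of_real x))) / (of_real x - z)) - of_real pi * f z) \<le> 8 * C / R"
proof -
  define I where "I w = integral {-R..R} (\<lambda>x. f (of_real x) / (of_real x - w))" for w
  let ?\<gamma> = "rectpath (- of_real R) (Complex R R)"
  have zR: "\<bar>Im z\<bar> \<le> R / 2" "\<bar>Re z\<bar> \<le> R / 2"
    using z abs_Im_le_cmod[of z] abs_Re_le_cmod[of z] by auto
  have box: "z \<in> box (- of_real R) (Complex R R)" using zR z R by (auto simp: in_box_complex_iff)
  have im: "path_image ?\<gamma> = cbox (- of_real R) (Complex R R) - box (- of_real R) (Complex R R)"
    using R by (intro path_image_rectpath_cbox_minus_box) auto
  have cvx: "convex {\<zeta>. - h < Im \<zeta>}" by (rule convex_halfspace_Im_gt)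
  have opn: "open {\<zeta>. - h < Im \<zeta>}" by (rule open_halfspace_Im_gt)
  have sub: "path_image ?\<gamma> \<subseteq> {\<zeta>. - h < Im \<zeta>} - {z}"
    unfolding im using box h by (auto simp: in_cbox_complex_iff)
  have "((\<lambda>\<zeta>. f \<zeta> / (\<zeta> - z)) has_contour_integral (of_real (2 * pi) * \<i> * winding_number ?\<gamma> z * f z)) ?\<gamma>"
    using sub z h by (intro Cauchy_integral_formula_convex_simple[OF cvx hol]) (auto simp: interior_open[OF opn])
  then have c1: "contour_integral ?\<gamma> (\<lambda>\<zeta>. f \<zeta> / (\<zeta> - z)) = 2 * of_real pi * \<i> * f z"
    by (simp add: winding_number_rectpath[OF box] contour_integral_unique)
  \<comment> \<open>Deep enough to contain the rectangle, not deep enough to contain the pole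
    \<open>cnj z\<close>.\<close>
  define S where "S = {\<zeta>. - min h (Im z) < Im \<zeta>}"
  have "((\<lambda>\<zeta>. f \<zeta> / (\<zeta> - cnj z)) has_contour_integral 0) ?\<gamma>"
  proof (rule Cauchy_theorem_convex_simple[of _ S])
    show "(\<lambda>\<zeta>. f \<zeta> / (\<zeta> - cnj z)) holomorphic_on S"
      unfolding S_def by (intro holomorphic_intros holomorphic_on_subset[OF hol]) auto
    show "convex S" unfolding S_def by (rule convex_halfspace_Im_gt)
    show "path_image ?\<gamma> \<subseteq> S" unfolding im S_def using h z by (auto simp: in_cbox_complex_iff)
  qed auto
  then have c2: "contour_integral ?\<gamma> (\<lambda>\<zeta>. f \<zeta> / (\<zeta> - cnj z)) = 0" by (rule contour_integral_unique)
  have 1: "cmod (I z - 2 * of_real pi * \<i> * f z) \<le> 8 * C / R"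
    using rectangle_bottom_estimate[OF hol h R decay, of z] z unfolding c1 I_def by simp
  have 2: "cmod (I (cnj z)) \<le> 8 * C / R"
    using rectangle_bottom_estimate[OF hol h R decay, of "cnj z"] z unfolding c2 I_def by simp
  have integrable: "(\<lambda>x. f (of_real x) / (of_real x - w)) integrable_on {-R..R}" if "Im w \<noteq> 0" for w
  proof -
    have "continuous_on {-R..R} (\<lambda>x. f (of_real x))"
      using h by (intro continuous_on_compose2[OF holomorphic_on_imp_continuous_on[OF hol]] continuous_intros) auto
    then show ?thesis using that by (intro integrable_continuous_interval continuous_intros) auto
  qed
  have "integral {-R..R} (\<lambda>x. cnj (f (of_real x) / (of_real x - cnj z))) = cnj (I (cnj z))"
    unfolding I_def using integral_linear[OF integrable[of "cnj z"] bounded_linear_cnj] z by (simp add: o_def)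
  then have "I z - cnj (I (cnj z)) = integral {-R..R} (\<lambda>x. f (of_real x) / (of_real x - z) - cnj (f (of_real x) / (of_real x - cnj z)))"
    unfolding I_def using integrable[of z] z integrable_linear[OF integrable[of "cnj z"] bounded_linear_cnj]
    by (subst integral_diff) (auto simp: o_def)
  also have "(\<lambda>x. f (of_real x) / (of_real x - z) - cnj (f (of_real x) / (of_real x - cnj z)))
     = (\<lambda>x. 2 * \<i> * (of_real (Im (f (of_real x))) / (of_real x - z)))"
    by (simp add: fun_eq_iff diff_divide_distrib[symmetric] complex_diff_cnj)
  also have "integral {-R..R} \<dots> = 2 * \<i> * integral {-R..R} (\<lambda>x. of_real (Im (f (of_real x))) / (of_real x - z))" (is "_ = _ * ?J")
    by (rule integral_mult_right)
  finally have J: "I z - cnj (I (cnj z)) = 2 * \<i> * ?J" .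
  have "2 * cmod (?J - of_real pi * f z) = cmod (2 * \<i> * ?J - 2 * of_real pi * \<i> * f z)"
    by (subst norm_mult[symmetric, of "2 * \<i>", simplified]) (simp add: algebra_simps)
  also have "\<dots> = cmod ((I z - 2 * of_real pi * \<i> * f z) - cnj (I (cnj z)))"
    unfolding J[symmetric] by (simp add: algebra_simps)
  also have "\<dots> \<le> 8 * C / R + 8 * C / R"
    using 1 2 norm_triangle_ineq4[of "I z - 2 * of_real pi * \<i> * f z" "cnj (I (cnj z))"]
    by (simp only: complex_mod_cnj)
  finally show ?thesis by simp
qed

text \<open>F lives on the open half plane only, so the Poisson estimate is applied to F(\<zeta> + i
  h). The height h = 1/(n+1) and the half-width n+1 of the rectangle share one index, so a single
  dominated limit handles both.\<close>

lemma stieltjes_from_boundary_values: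
  fixes F :: "complex \<Rightarrow> complex" and g B :: "real \<Rightarrow> real"
  assumes hol: "F holomorphic_on {z. 0 < Im z}"
    and decay: "\<And>z. 0 < Im z \<Longrightarrow> R \<le> cmod z \<Longrightarrow> cmod (F z) \<le> C / cmod z"
    and dom: "\<And>x h. x \<noteq> 0 \<Longrightarrow> 0 < h \<Longrightarrow> h \<le> 1 \<Longrightarrow> \<bar>Im (F (Complex x h))\<bar> \<le> B x"
    and B: "integrable lborel B"
    and lim: "AE x in lborel. ((\<lambda>h. Im (F (Complex x h))) \<longlongrightarrow> g x) (at_right 0)"
    and g: "g \<in> borel_measurable borel"
    and z: "0 < Im z"
  shows "(LBINT x. of_real (g x) / (of_real x - z)) = of_real pi * F z"
proof -
  define s where "s n x = indicator {- real (Suc n)..real (Suc n)} x *\<^sub>R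
      (of_real (Im (F (Complex x (1 / Suc n)))) / (of_real x - z))" for n x
  have cont: "continuous_on UNIV (\<lambda>x. of_real (Im (F (Complex x h))) / (of_real x - z))" if "0 < h" for h
  proof -
    have "continuous_on UNIV (\<lambda>x. F (of_real x + \<i> * of_real h))"
      using that by (intro continuous_on_compose2[OF holomorphic_on_imp_continuous_on[OF hol]] continuous_intros) auto
    then have "continuous_on UNIV (\<lambda>x. F (Complex x h))" by (simp add: Complex_eq)
    then show ?thesis using z by (intro continuous_intros) auto
  qed
  have meas: "(\<lambda>x. of_real (Im (F (Complex x h))) / (of_real x - z)) \<in> borel_measurable borel" if "0 < h" for h
    using cont[OF that] by (rule borel_measurable_continuous_onI)
  have [measurable]: "s n \<in> borel_measurable lborel" for n
    unfolding s_def using meas[of "1 / Suc n"] by simp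
  have [measurable]: "(\<lambda>x. of_real (g x) / (of_real x - z)) \<in> borel_measurable lborel"
    using g by simp
  have AE0: "AE x in lborel. x \<noteq> (0::real)" by (rule AE_lborel_singleton)
  have xz: "Im z \<le> cmod (of_real x - z)" for x using abs_Im_le_cmod[of "of_real x - z"] by simp
  have "(\<lambda>n. LBINT x. s n x) \<longlonglongrightarrow> (LBINT x. of_real (g x) / (of_real x - z))"
  proof (rule integral_dominated_convergence[where w="\<lambda>x. B x / Im z"])
    show "integrable lborel (\<lambda>x. B x / Im z)" using B by simp
    show "AE x in lborel. (\<lambda>n. s n x) \<longlonglongrightarrow> of_real (g x) / (of_real x - z)"
      using lim
    proof eventually_elim
      case (elim x)
      have fl: "filterlim (\<lambda>n. 1 / real (Suc n)) (at_right 0) sequentially"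
        unfolding filterlim_at by (auto intro!: LIMSEQ_Suc[OF lim_1_over_n] simp del: of_nat_Suc)
      have *: "(\<lambda>n. of_real (Im (F (Complex x (1 / Suc n)))) / (of_real x - z)) \<longlonglongrightarrow> of_real (g x) / (of_real x - z)"
        using filterlim_compose[OF elim fl] z by (intro tendsto_intros) auto
      obtain m where m: "\<bar>x\<bar> \<le> real m" using real_arch_simple by blast
      have "\<forall>\<^sub>F n in sequentially. of_real (Im (F (Complex x (1 / Suc n)))) / (of_real x - z) = s n x"
        using eventually_ge_at_top[of m] by eventually_elim (use m in \<open>auto simp: s_def indicator_def\<close>)
      then show ?case by (rule Lim_transform_eventually[OF *])
    qed
    show "AE x in lborel. cmod (s n x) \<le> B x / Im z" for n
      using AE0
    proof eventually_elim
      case (elim x)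
      have b: "\<bar>Im (F (Complex x (1 / Suc n)))\<bar> \<le> B x" using dom[OF elim, of "1 / Suc n"] by simp
      have "cmod (s n x) \<le> \<bar>Im (F (Complex x (1 / Suc n)))\<bar> / cmod (of_real x - z)"
        by (auto simp: s_def indicator_def norm_divide)
      also have "\<dots> \<le> B x / Im z" using b xz z by (intro frac_le) auto
      finally show ?case .
    qed
  qed auto
  moreover have "(\<lambda>n. LBINT x. s n x) \<longlonglongrightarrow> of_real pi * F z"
  proof -
    define e where "e n = (LBINT x. s n x) - of_real pi * F (z + \<i> * of_real (1 / Suc n))" for n
    have s_int: "(LBINT x. s n x) = integral {- real (Suc n)..real (Suc n)} (\<lambda>x. of_real (Im (F (Complex x (1 / Suc n)))) / (of_real x - z))" for n
    proof -
      have "set_integrable lborel {- real (Suc n)..real (Suc n)} (\<lambda>x. of_real (Im (F (Complex x (1 / Suc n)))) / (of_real x - z))"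
        unfolding set_integrable_def
        by (rule borel_integrable_compact) (auto intro: continuous_on_subset[OF cont] simp del: of_nat_Suc)
      from set_borel_integral_eq_integral(2)[OF this] show ?thesis by (simp add: s_def set_lebesgue_integral_def)
    qed
    obtain m where m: "max R (2 * cmod z) \<le> real m" using real_arch_simple by blast
    have "\<forall>\<^sub>F n in sequentially. norm (e n) \<le> 8 * C / Suc n"
      using eventually_ge_at_top[of m]
    proof eventually_elim
      case (elim n)
      define h where "h = 1 / real (Suc n)"
      have h: "0 < h" by (simp add: h_def)
      have Rn: "R \<le> Suc n" "cmod z \<le> Suc n / 2" using m elim by auto
      have "cmod (integral {- real (Suc n)..real (Suc n)} (\<lambda>x. of_real (Im (F (of_real x + \<i> * of_real h))) / (of_real x - z))
           - of_real pi * F (z + \<i> * of_real h)) \<le> 8 * C / Suc n"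
      proof (rule half_plane_poisson_estimate[where f="\<lambda>\<zeta>. F (\<zeta> + \<i> * of_real h)" and h=h])
        have "(F \<circ> (\<lambda>\<zeta>. \<zeta> + \<i> * of_real h)) holomorphic_on {\<zeta>. - h < Im \<zeta>}"
          by (rule holomorphic_on_compose_gen[OF _ hol]) (auto intro!: holomorphic_intros)
        then show "(\<lambda>\<zeta>. F (\<zeta> + \<i> * of_real h)) holomorphic_on {\<zeta>. - h < Im \<zeta>}" by (simp add: o_def)
        fix \<zeta> :: complex assume \<zeta>: "0 \<le> Im \<zeta>" "real (Suc n) \<le> cmod \<zeta>"
        have le: "cmod \<zeta> \<le> cmod (\<zeta> + \<i> * of_real h)"
          unfolding cmod_def using \<zeta> h by (auto intro!: real_sqrt_le_mono power_mono)
        have "cmod (F (\<zeta> + \<i> * of_real h)) \<le> C / cmod (\<zeta> + \<i> * of_real h)"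
          using \<zeta> h le Rn by (intro decay) auto
        moreover have C: "0 \<le> C"
          using order_trans[OF norm_ge_zero calculation] \<zeta> le by (auto simp: zero_le_divide_iff)
        moreover have "C / cmod (\<zeta> + \<i> * of_real h) \<le> C / Suc n"
          using le \<zeta> C by (intro divide_left_mono) (auto intro!: mult_pos_pos)
        ultimately show "cmod (F (\<zeta> + \<i> * of_real h)) \<le> C / Suc n" by linarith
      qed (use z h Rn in auto)
      then show ?case by (simp add: e_def s_int h_def Complex_eq)
    qed
    moreover have "(\<lambda>n. 8 * C / Suc n) \<longlonglongrightarrow> 0"
      using LIMSEQ_Suc[OF lim_const_over_n[of "8 * C"]] by simp
    ultimately have e: "e \<longlonglongrightarrow> 0" by (rule Lim_null_comparison)
    have "isCont F z" using holomorphic_on_imp_continuous_on[OF hol] z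
      by (subst (asm) continuous_on_eq_continuous_at) (auto simp: open_halfspace_Im_gt)
    moreover have "(\<lambda>n. z + \<i> * of_real (1 / Suc n)) \<longlonglongrightarrow> z + \<i> * of_real 0"
      by (intro tendsto_intros LIMSEQ_Suc[OF lim_1_over_n])
    ultimately have "(\<lambda>n. F (z + \<i> * of_real (1 / Suc n))) \<longlonglongrightarrow> F z"
      using isCont_tendsto_compose[of z F] by simp
    then have "(\<lambda>n. e n + of_real pi * F (z + \<i> * of_real (1 / Suc n))) \<longlonglongrightarrow> 0 + of_real pi * F z"
      by (intro tendsto_intros e)
    then show ?thesis by (simp add: e_def)
  qed
  ultimately show ?thesis by (rule LIMSEQ_unique)
qed

text \<open>The exponent -1/2 matches the bound (k |z|)^(-1/2) on G near 0, the exponent -2 the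
  decay of Im G at infinity. Both terms count at |x| = 1, which is harmless for a majorant.\<close>

definition power_majorant :: "real \<Rightarrow> real" where
  "power_majorant x = indicator {0<..1} \<bar>x\<bar> * \<bar>x\<bar> powr (-1/2) + indicator {1..} \<bar>x\<bar> * \<bar>x\<bar> powr (-2)"

lemma integrable_power_majorant: "integrable lborel power_majorant"
proof -
  define h where "h x = indicator {0<..1} x *\<^sub>R (x powr (-1/2)) + indicator {1..} x *\<^sub>R (x powr (-2))" for x :: real
  have 1: "(\<lambda>x::real. x powr (-1/2)) integrable_on {0<..1}" by (rule integrable_on_powr_from_0') auto
  have 2: "(\<lambda>x::real. x powr (-2)) integrable_on {1..}"
    using has_integral_powr_to_inf[of "-2" "1::real"] by (auto simp: integrable_on_def)
  have "integrable lebesgue (\<lambda>x::real. indicator {0<..1} x *\<^sub>R (x powr (-1/2)))"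
    using nonnegative_absolutely_integrable_1[OF 1] by (simp add: set_integrable_def)
  then have "integrable lborel (\<lambda>x::real. indicator {0<..1} x *\<^sub>R (x powr (-1/2)))"
    by (subst (asm) integrable_completion) auto
  moreover have "integrable lebesgue (\<lambda>x::real. indicator {1..} x *\<^sub>R (x powr (-2)))"
    using nonnegative_absolutely_integrable_1[OF 2] by (simp add: set_integrable_def)
  then have "integrable lborel (\<lambda>x::real. indicator {1..} x *\<^sub>R (x powr (-2)))"
    by (subst (asm) integrable_completion) auto
  ultimately have h: "integrable lborel h" unfolding h_def by (rule Bochner_Integration.integrable_add)
  have pm_eq: "power_majorant = (\<lambda>x. h x + h (0 + (-1) * x))"
    by (auto simp: fun_eq_iff power_majorant_def h_def indicator_def abs_if)
  show ?thesis unfolding pm_eq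
    by (intro Bochner_Integration.integrable_add h lborel_integrable_real_affine) simp
qed

section \<open>The fixed point equation\<close>

lemma Im_of_real_divide: "Im (of_real c / w) = - c * Im w / (cmod w)\<^sup>2"
  by (simp add: Im_divide cmod_power2)

lemma Im_of_real_mult: "Im (of_real c * x) = c * Im x"
  by simp

text \<open>A Perron--Frobenius bound: the matrix with rows (ms, m) and (m Z^2, ms), whose spectral
  radius is m (Z + s), maps the positive vector (p, q) below itself.\<close>

lemma weighted_pair_bound:
  fixes p q m Z s :: real
  assumes "0 < p" "0 < q" "0 < m" "0 < Z" "0 \<le> s"
    and "p = m * (q + s * p)" "m * (Z\<^sup>2 * p + s * q) < q"
  shows "m * (Z + s) < 1"
proof -
  define e where "e = 1 - m * s"
  have 1: "e * p = m * q" using assms(6) by (simp add: e_def algebra_simps)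
  have 2: "m * Z\<^sup>2 * p < e * q" using assms(7) by (simp add: e_def algebra_simps)
  have e: "0 < e" using 1 assms by (metis mult_pos_pos zero_less_mult_pos2)
  have "(m * Z)\<^sup>2 * q = e * (m * Z\<^sup>2 * p)"
    using 1 by (simp add: power2_eq_square algebra_simps)
  also have "\<dots> < e * (e * q)" using e 2 by (rule mult_strict_left_mono[rotated])
  finally have "(m * Z)\<^sup>2 < e\<^sup>2" using assms(2) by (simp add: power2_eq_square)
  then have "m * Z < e" using e by (simp add: power_less_imp_less_base)
  then show ?thesis by (simp add: e_def algebra_simps)
qed

lemma two_mult_le: "2 * (x * y) \<le> x\<^sup>2 + (y::real)\<^sup>2"
  using sum_squares_bound[of x y] by (simp add: mult.assoc)

text \<open>With k = r t and b = t - r t, \<open>b_nonneg\<close> encodes r <= 1.\<close>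

locale self_energy =
  fixes k b a :: real
  assumes k_pos: "0 < k" and b_nonneg: "0 \<le> b" and a_pos: "0 < a"
begin

text \<open>Multiplying the defining equation by w and using w/G = 1/G - k turns it into 1/G = z w -
  b - a/w; \<open>D\<close> is this expression for 1/G.\<close>

definition D :: "complex \<Rightarrow> complex \<Rightarrow> complex" where
  "D z w = z * w - of_real b - of_real a / w"

definition T :: "complex \<Rightarrow> complex \<Rightarrow> complex" where
  "T z w = 1 - of_real k / D z w"

text \<open>The two positivity conditions select, among the roots of the cubic, the branch
  1 - k G with G a Stieltjes transform of a measure on the positive half line.\<close>

definition sol :: "complex \<Rightarrow> complex \<Rightarrow> bool" where
  "sol z w \<longleftrightarrow> 0 < Im w \<and> 0 < Im (z * w) \<and> w = T z w"



section \<open>Positivity, uniqueness and existence of the fixed point\<close>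

lemma Im_D: "Im (D z w) = Im (z * w) + a * Im w / (cmod w)\<^sup>2"
  by (simp add: D_def Im_of_real_divide)

lemma D_nonzero:
  assumes "0 < Im w" "0 < Im (z * w)"
  shows "D z w \<noteq> 0"
proof -
  have "0 < Im (D z w)"
    using assms a_pos by (auto simp: Im_D simp del: times_complex.sel intro!: add_pos_nonneg)
  then show ?thesis by auto
qed

lemma Im_T: "Im (T z w) = k / (cmod (D z w))\<^sup>2 * (Im (z * w) + a / (cmod w)\<^sup>2 * Im w)"
  by (simp add: T_def Im_of_real_divide Im_D del: times_complex.sel)

text \<open>At a fixed point this and \<open>Im_T\<close> form a linear system for the pair (Im w,
  Im (z w)) with nonnegative coefficients and a source at least Im z. Invariance of the cone and
  \<open>sol_key\<close> both come from it.\<close>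

lemma Im_z_T:
  assumes "w \<noteq> 0"
  shows "Im (z * T z w) = Im z + k / (cmod (D z w))\<^sup>2 *
    ((cmod z)\<^sup>2 * Im w + b * Im z + a / (cmod w)\<^sup>2 * Im (z * w))"
proof -
  have "z * cnj (D z w) = of_real ((cmod z)\<^sup>2) * cnj w - of_real b * z - of_real a * (z / cnj w)"
    by (simp add: D_def algebra_simps complex_norm_square del: of_real_power)
  also have "z / cnj w = of_real (1 / (cmod w)\<^sup>2) * (z * w)"
    using assms by (simp add: complex_norm_square of_real_divide del: of_real_power)
  finally have "Im (z * cnj (D z w)) = - ((cmod z)\<^sup>2 * Im w + b * Im z + a / (cmod w)\<^sup>2 * Im (z * w))"
    by (simp only: Im_of_real_mult minus_complex.sel cnj.sel) simp
  moreover have "Im (z / D z w) = Im (z * cnj (D z w)) / (cmod (D z w))\<^sup>2"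
    using Im_divide_of_real[of "z * cnj (D z w)" "(cmod (D z w))\<^sup>2"] complex_div_cnj[of z "D z w"] by simp
  moreover have "Im (z * T z w) = Im z - k * Im (z / D z w)"
    by (simp add: T_def algebra_simps Im_divide)
  moreover have "x - k * (- y / n) = x + k / n * y" for x y n :: real by simp
  ultimately show ?thesis by (simp only:)
qed


lemma sol_nonzero:
  assumes "sol z w" shows "w \<noteq> 0" "z \<noteq> 0" "D z w \<noteq> 0"
  using assms D_nonzero[of w z] by (auto simp: sol_def)

text \<open>\<open>weighted_pair_bound\<close> with p = Im w, q = Im (z w), Z = |z|, s = a/|w|^2 and
  m = k/|D|^2; the source Im z > 0 makes it strict. The left side dominates the modulus of the
  derivative of T at w.\<close>

lemma sol_key:
  assumes z: "0 < Im z" and w: "sol z w"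
  shows "k / (cmod (D z w))\<^sup>2 * (cmod z + a / (cmod w)\<^sup>2) < 1"
proof (rule weighted_pair_bound)
  note nz = sol_nonzero[OF w]
  have w': "w = T z w" using w by (simp add: sol_def)
  show "0 < Im w" "0 < Im (z * w)" using w by (auto simp: sol_def simp del: times_complex.sel)
  show m: "0 < k / (cmod (D z w))\<^sup>2" using k_pos nz by simp
  show "0 < cmod z" "0 \<le> a / (cmod w)\<^sup>2" using nz a_pos by auto
  show "Im w = k / (cmod (D z w))\<^sup>2 * (Im (z * w) + a / (cmod w)\<^sup>2 * Im w)"
    using Im_T[of z w] w' by simp
  have "Im (z * w) = Im z + k / (cmod (D z w))\<^sup>2 *
    ((cmod z)\<^sup>2 * Im w + b * Im z + a / (cmod w)\<^sup>2 * Im (z * w))"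
    using Im_z_T[OF nz(1), of z] w' by (simp del: times_complex.sel)
  moreover have "0 \<le> k / (cmod (D z w))\<^sup>2 * (b * Im z)" using m b_nonneg z by (intro mult_nonneg_nonneg) auto
  ultimately show "k / (cmod (D z w))\<^sup>2 * ((cmod z)\<^sup>2 * Im w + a / (cmod w)\<^sup>2 * Im (z * w)) < Im (z * w)"
    using z by (simp add: algebra_simps del: times_complex.sel)
qed

lemma sol_eq:
  assumes "sol z w" shows "of_real k / D z w = 1 - w"
proof -
  have "w = 1 - of_real k / D z w" using assms unfolding sol_def T_def by blast
  then have "w + of_real k / D z w = 1" by (metis diff_add_cancel)
  then show ?thesis by (metis add_diff_cancel_left')
qed

text \<open>Subtract the two equations 1 - w = k/D: an exact difference quotient. It yields
  uniqueness for z = z' and the derivative for z' tending to z.\<close>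

lemma sol_diff:
  fixes z w z' w' :: complex
  assumes w: "sol z w" and w': "sol z' w'"
  defines "c \<equiv> complex_of_real k / (D z w * D z' w')"
  shows "(w - w') * (1 - c * (z + a / (w * w'))) = c * w' * (z - z')"
proof -
  note nz = sol_nonzero[OF w] sol_nonzero[OF w']
  have "w - w' = k / D z' w' - k / D z w"
    by (simp add: sol_eq[OF w] sol_eq[OF w'])
  also have "\<dots> = c * (D z w - D z' w')"
    using nz by (simp add: c_def field_simps)
  also have "D z w - D z' w' = (w - w') * (z + a / (w * w')) + w' * (z - z')"
    using nz by (simp add: D_def field_simps)
  finally show ?thesis by (simp add: algebra_simps)
qed


text \<open>The arithmetic-geometric inequality bounds the mixed product by the quantities of
  \<open>sol_key\<close> at the two points. The one at (z', w') appears with |z| in place of |z'|,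
  which costs the last summand; what remains of it is below 1.\<close>

lemma sol_contraction:
  fixes z w z' w' :: complex
  assumes z: "0 < Im z" "0 < Im z'" and w: "sol z w" and w': "sol z' w'"
  defines "c \<equiv> complex_of_real k / (D z w * D z' w')"
  shows "2 * cmod (c * (z + a / (w * w'))) \<le>
     k / (cmod (D z w))\<^sup>2 * (cmod z + a / (cmod w)\<^sup>2) + 1 + k / (cmod (D z' w'))\<^sup>2 * cmod (z' - z)"
proof -
  define d d' e e' where "d = 1 / cmod (D z w)" "d' = 1 / cmod (D z' w')"
    "e = 1 / cmod w" "e' = 1 / cmod w'"
  note def = this
  have "cmod (c * (z + a / (w * w'))) \<le> cmod c * (cmod z + cmod (a / (w * w')))"
    unfolding norm_mult by (intro mult_left_mono norm_triangle_ineq) auto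
  also have "\<dots> = k * (cmod z * (d * d') + a * ((d * e) * (d' * e')))"
    using k_pos a_pos by (simp add: c_def def norm_mult norm_divide algebra_simps add_divide_distrib)
  finally have "2 * cmod (c * (z + a / (w * w'))) \<le> k * (cmod z * (2 * (d * d')) + a * (2 * ((d * e) * (d' * e'))))"
    by (simp add: algebra_simps)
  also have "\<dots> \<le> k * (cmod z * (d\<^sup>2 + d'\<^sup>2) + a * ((d * e)\<^sup>2 + (d' * e')\<^sup>2))"
    using k_pos a_pos two_mult_le[of d d'] two_mult_le[of "d * e" "d' * e'"]
    by (intro mult_left_mono add_mono) auto
  also have "\<dots> = k / (cmod (D z w))\<^sup>2 * (cmod z + a / (cmod w)\<^sup>2) + k * d'\<^sup>2 * (cmod z + a * e'\<^sup>2)"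
    by (simp add: def power_divide power_mult_distrib distrib_left)
  also have "k * d'\<^sup>2 * (cmod z + a * e'\<^sup>2) \<le> k * d'\<^sup>2 * (cmod z' + a * e'\<^sup>2) + k * d'\<^sup>2 * cmod (z' - z)"
  proof -
    have "cmod z \<le> cmod z' + cmod (z' - z)" using norm_triangle_ineq2[of z z'] by (simp add: norm_minus_commute)
    then have "k * d'\<^sup>2 * (cmod z + a * e'\<^sup>2) \<le> k * d'\<^sup>2 * ((cmod z' + cmod (z' - z)) + a * e'\<^sup>2)"
      using k_pos a_pos by (intro mult_left_mono add_mono) auto
    then show ?thesis by (simp add: algebra_simps)
  qed
  also have "k * d'\<^sup>2 * (cmod z' + a * e'\<^sup>2) < 1"
    using sol_key[OF z(2) w'] by (simp add: def power_divide)
  finally show ?thesis by (simp add: def power_divide)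
qed

lemma sol_unique:
  assumes z: "0 < Im z" and w: "sol z w" and w': "sol z w'"
  shows "w = w'"
proof -
  define c where "c = k / (D z w * D z w')"
  have "cmod (c * (z + a / (w * w'))) < 1"
    using sol_contraction[OF z z w w'] sol_key[OF z w] by (simp add: c_def)
  then have "1 - c * (z + a / (w * w')) \<noteq> 0" by (metis norm_one less_irrefl eq_iff_diff_eq_0)
  then show ?thesis using sol_diff[OF w w'] unfolding c_def[symmetric] by simp
qed

text \<open>Brouwer's theorem needs a compact convex set, so the open cone is truncated by
  quantitative lower bounds on Im w and Im (z w) and by a ball.\<close>

lemma sol_exists:
  assumes z: "0 < Im z"
  shows "\<exists>w. sol z w"
proof -
  define y where "y = Im z"
  have y: "0 < y" "y \<le> cmod z" using z abs_Im_le_cmod[of z] by (auto simp: y_def)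
  \<comment> \<open>Bounds |D| from |w| <= 1 + k/y and |w| >= y/|z|.\<close>
  define L where "L = cmod z * (1 + k / y) + b + a * cmod z / y"
  have L: "0 < L" unfolding L_def using y k_pos b_nonneg a_pos
    by (intro add_pos_nonneg mult_pos_pos) auto
  \<comment> \<open>A lower bound for Im (T w), by \<open>Im_T\<close> with Im (z w) >= y and |D| <=
    L.\<close>
  define c where "c = k * y / L\<^sup>2"
  have c: "0 < c" using k_pos y L by (simp add: c_def)
  \<comment> \<open>Inner products present the two conditions Im (z w) >= y and Im w >= c as closed
    half spaces.\<close>
  define K where "K = cball 1 (k / y) \<inter> {w. inner (Complex (Im z) (Re z)) w \<ge> y} \<inter> {w. inner \<i> w \<ge> c}"
  have inner: "inner (Complex (Im z) (Re z)) w = Im (z * w)" "inner \<i> w = Im w" for w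
    by (simp_all add: inner_complex_def algebra_simps)
  have TK: "T z w \<in> K" if w: "0 < Im w" "y \<le> Im (z * w)" "cmod (w - 1) \<le> k / y" for w
  proof -
    have w0: "w \<noteq> 0" using w by auto
    have q: "0 < Im (z * w)" using w y by linarith
    have "y \<le> Im (D z w)" unfolding Im_D using w a_pos by (simp add: add_increasing2 del: times_complex.sel)
    then have Dy: "y \<le> cmod (D z w)" using abs_Im_le_cmod[of "D z w"] by linarith
    have "cmod w \<le> 1 + k / y" using w(3) norm_triangle_ineq2[of w 1] by simp
    moreover have "a / cmod w \<le> a * cmod z / y"
    proof -
      have "y \<le> cmod z * cmod w" using w(2) abs_Im_le_cmod[of "z * w"] by (simp add: norm_mult del: times_complex.sel)
      then show ?thesis using w0 a_pos y by (simp add: field_simps)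
    qed
    moreover have "cmod (D z w) \<le> cmod z * cmod w + b + a / cmod w"
      unfolding D_def using b_nonneg a_pos
      by (intro order_trans[OF norm_triangle_ineq4] add_mono) (auto simp: norm_mult norm_divide)
    ultimately have DL: "cmod (D z w) \<le> L" unfolding L_def
      using mult_left_mono[of "cmod w" "1 + k/y" "cmod z"] by simp
    have "c \<le> Im (T z w)"
    proof -
      have "c \<le> k / (cmod (D z w))\<^sup>2 * y" unfolding c_def times_divide_eq_left
        using Dy y DL k_pos by (intro divide_left_mono mult_pos_pos zero_less_power power_mono) auto
      also have "\<dots> \<le> Im (T z w)" unfolding Im_T using k_pos a_pos w
        by (intro mult_left_mono) (auto simp del: times_complex.sel intro: add_increasing2)
      finally show ?thesis .
    qed
    moreover have "y \<le> Im (z * T z w)" unfolding Im_z_T[OF w0] y_def[symmetric]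
      using k_pos a_pos b_nonneg y w q by (simp del: times_complex.sel)
    moreover have "cmod (T z w - 1) \<le> k / y"
      using Dy y k_pos by (simp add: T_def norm_divide frac_le)
    ultimately show ?thesis by (simp add: K_def inner dist_norm norm_minus_commute del: times_complex.sel)
  qed
  have K: "0 < Im w" "y \<le> Im (z * w)" "cmod (w - 1) \<le> k / y" if "w \<in> K" for w
    using that c by (auto simp: K_def inner dist_norm norm_minus_commute simp del: times_complex.sel)
  have "compact K" unfolding K_def
    by (intro compact_Int_closed closed_halfspace_ge compact_cball)
  moreover have "convex K" unfolding K_def
    by (intro convex_Int convex_halfspace_ge convex_cball)
  moreover have "K \<noteq> {}"
  proof -
    \<comment> \<open>Here z w differs from z by a real number, and the factor of
      \<open>cnj z\<close> puts w at distance k/y from 1. This w may violate Im w >= c, but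
      \<open>TK\<close> asks only for Im w > 0, so its image lies in K.\<close>
    define w where "w = 1 - (k / (y * cmod z)) * cnj z"
    have "z * w = z - of_real (k / (y * cmod z)) * of_real ((cmod z)\<^sup>2)"
      unfolding complex_norm_square by (simp add: w_def algebra_simps)
    then have "y \<le> Im (z * w)"
      by (simp only: Im_of_real_mult minus_complex.sel Im_complex_of_real y_def)
    moreover have "0 < Im w" using y k_pos z by (auto simp: w_def intro!: divide_pos_pos mult_pos_pos)
    moreover have "cmod (w - 1) \<le> k / y" using y k_pos by (simp add: w_def norm_mult norm_divide)
    ultimately show ?thesis using TK by blast
  qed
  moreover have "continuous_on K (T z)"
    unfolding T_def D_def
    using K y D_nonzero[of _ z] 
    by (intro continuous_intros) (auto simp: D_def simp del: times_complex.sel, force, fastforce)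
  moreover have "T z \<in> K \<rightarrow> K" using K TK by auto
  ultimately obtain w where "w \<in> K" "T z w = w" by (rule brouwer)
  then show ?thesis using K[of w] y by (auto simp: sol_def simp del: times_complex.sel intro!: exI[of _ w])
qed

section \<open>The selected branch: holomorphy and asymptotics\<close>

definition W :: "complex \<Rightarrow> complex" where
  "W z = (SOME w. sol z w)"

definition G :: "complex \<Rightarrow> complex" where
  "G z = (1 - W z) / of_real k"

lemma sol_W: "0 < Im z \<Longrightarrow> sol z (W z)"
  unfolding W_def using sol_exists by (rule someI_ex)

lemma W_eq_G: "W z = 1 - of_real k * G z"
  using k_pos by (simp add: G_def)

lemma G_eq: "0 < Im z \<Longrightarrow> G z = 1 / D z (W z)"
  unfolding G_def sol_eq[OF sol_W, symmetric] using k_pos by simp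

lemma G_nonzero: "0 < Im z \<Longrightarrow> G z \<noteq> 0"
  using sol_nonzero[OF sol_W] by (simp add: G_eq)

lemma G_key: "0 < Im z \<Longrightarrow> k * (cmod (G z))\<^sup>2 * (cmod z + a / (cmod (W z))\<^sup>2) < 1"
  using sol_key[OF _ sol_W] by (simp add: G_eq norm_divide power_divide)

lemma G_bound:
  assumes "0 < Im z" shows "k * (cmod (G z))\<^sup>2 * cmod z < 1"
proof -
  have "k * (cmod (G z))\<^sup>2 * cmod z \<le> k * (cmod (G z))\<^sup>2 * (cmod z + a / (cmod (W z))\<^sup>2)"
    using k_pos a_pos by (intro mult_left_mono) auto
  then show ?thesis using G_key[OF assms] by linarith
qed

lemma G_equation:
  assumes "0 < Im z"
  shows "z = 1 / G z + of_real (b + k) / W z + of_real a / (W z)\<^sup>2"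
proof -
  note nz = sol_nonzero[OF sol_W[OF assms]]
  have "1 / G z = z * W z - b - a / W z" using assms by (simp add: G_eq D_def)
  moreover have "W z / G z = 1 / G z - k"
    using G_nonzero[OF assms] by (simp add: W_eq_G diff_divide_distrib)
  ultimately have "z * W z = W z / G z + (b + k) + a / W z" by simp
  then show ?thesis using nz by (simp add: field_simps power2_eq_square)
qed

text \<open>In \<open>sol_diff\<close> the factor 1 - c' stays away from 0 for z' near z by
  \<open>sol_contraction\<close>. This gives continuity of W, which must be known before the limit
  of the difference quotient can be taken.\<close>

lemma W_lipschitz:
  assumes z: "0 < Im z"
  shows "\<exists>C. \<forall>\<^sub>F z' in at z. dist (W z') (W z) \<le> C * dist z' z"
proof -
  define \<rho> where "\<rho> = k * (cmod (G z))\<^sup>2 * (cmod z + a / (cmod (W z))\<^sup>2)"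
  \<comment> \<open>The numerator bounds |c W(z')|, the denominator is the lower bound for |1 -
    c'|.\<close>
  define C where "C = (2 / cmod z * (2 + 2 * k / cmod z)) / ((1 - \<rho>) / 4)"
  have \<rho>: "\<rho> < 1" using G_key[OF z] by (simp add: \<rho>_def)
  have \<rho>0: "0 \<le> \<rho>" using k_pos a_pos by (auto simp: \<rho>_def)
  have Z: "0 < cmod z" using z by auto
  have *: "dist (W z') (W z) \<le> C * dist z' z"
    \<comment> \<open>This radius keeps |z'| >= |z|/2 and makes the error term of
      \<open>sol_contraction\<close> at most (1 - \<rho>)/2.\<close>
    if z': "0 < Im z'" and d: "dist z' z < (1 - \<rho>) * cmod z / 4" for z'
  proof -
    define c where "c = of_real k * (G z * G z')"
    define c' where "c' = c * (z + a / (W z * W z'))"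
    define m m' where "m = k * (cmod (G z))\<^sup>2" and "m' = k * (cmod (G z'))\<^sup>2"
    have c_eq: "c = k / (D z (W z) * D z' (W z'))" by (simp add: c_def G_eq z z')
    have Z': "cmod z / 2 \<le> cmod z'"
    proof -
      have "cmod z \<le> cmod z' + dist z' z" using norm_triangle_ineq2[of z z'] by (simp add: dist_norm norm_minus_commute)
      moreover have "(1 - \<rho>) * cmod z / 4 \<le> cmod z / 4" using \<rho>0 Z by (simp add: mult_le_cancel_right1)
      ultimately show ?thesis using d Z by linarith
    qed
    have "m' * cmod z' < 1" using G_bound[OF z'] by (simp add: m'_def)
    moreover have m'0: "0 \<le> m'" using k_pos by (simp add: m'_def)
    ultimately have "m' * (cmod z / 2) < 1" using Z' mult_left_mono[of "cmod z / 2" "cmod z'" m'] by linarith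
    then have m': "m' < 2 / cmod z" using Z by (simp add: field_simps)
    have "m * cmod z < 1" using G_bound[OF z] by (simp add: m_def)
    then have m: "m < 1 / cmod z" using Z by (simp add: field_simps)
    have "2 * cmod c' \<le> \<rho> + 1 + m' * dist z' z"
      using sol_contraction[OF z z' sol_W[OF z] sol_W[OF z']]
      unfolding c'_def c_eq \<rho>_def m'_def by (simp add: G_eq z z' norm_divide power_divide dist_norm)
    also have "m' * dist z' z \<le> 2 / cmod z * ((1 - \<rho>) * cmod z / 4)"
      using m' d m'0 \<rho> Z by (intro mult_mono) auto
    also have "\<dots> = (1 - \<rho>) / 2" using Z by simp
    finally have "2 * cmod c' \<le> \<rho> + 1 + (1 - \<rho>) / 2" by simp
    then have c': "cmod c' \<le> 1 - (1 - \<rho>) / 4" by argo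
    have "(1 - \<rho>) / 4 \<le> cmod (1 - c')" using c' norm_triangle_ineq2[of 1 c'] unfolding norm_one by argo
    then have "cmod (W z - W z') * ((1 - \<rho>) / 4) \<le> cmod (W z - W z') * cmod (1 - c')"
      by (intro mult_left_mono) auto
    also have "\<dots> = cmod ((W z - W z') * (1 - c'))" by (simp add: norm_mult)
    also have "(W z - W z') * (1 - c') = c * W z' * (z - z')"
      using sol_diff[OF sol_W[OF z] sol_W[OF z']] unfolding c'_def c_eq by simp
    also have "cmod \<dots> = cmod c * cmod (W z') * cmod (z - z')" by (simp add: norm_mult)
    also have "\<dots> \<le> 2 / cmod z * (2 + 2 * k / cmod z) * cmod (z - z')"
    proof (intro mult_right_mono mult_mono)
      have "2 * cmod c \<le> m + m'" using two_mult_le[of "cmod (G z)" "cmod (G z')"] k_pos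
        by (simp add: c_def m_def m'_def norm_mult distrib_left[symmetric])
      also have "\<dots> \<le> 4 / cmod z" using m m' Z by (simp add: field_simps)
      finally show "cmod c \<le> 2 / cmod z" by simp
      have "cmod (W z') \<le> 1 + k * cmod (G z')"
        unfolding W_eq_G using norm_triangle_ineq4[of 1 "k * G z'"] k_pos by (simp add: norm_mult)
      also have "k * cmod (G z') \<le> 1 + (k * cmod (G z'))\<^sup>2"
        using two_mult_le[of "k * cmod (G z')" 1] k_pos norm_ge_zero[of "G z'"]
        by (smt (verit, best) mult_nonneg_nonneg one_power2 mult.right_neutral)
      also have "(k * cmod (G z'))\<^sup>2 = k * m'" by (simp add: m'_def power2_eq_square)
      also have "\<dots> \<le> k * (2 / cmod z)" using m' k_pos by (intro mult_left_mono) auto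
      finally show "cmod (W z') \<le> 2 + 2 * k / cmod z" by (simp add: algebra_simps)
    qed (use Z in auto)
    finally have "cmod (W z - W z') \<le> 2 / cmod z * (2 + 2 * k / cmod z) * cmod (z - z') / ((1 - \<rho>) / 4)"
      using \<rho> by (subst pos_le_divide_eq) auto
    then show ?thesis unfolding C_def dist_norm norm_minus_commute[of "W z'"] norm_minus_commute[of z']
      by (simp only: times_divide_eq_left)
  qed
  have "\<forall>\<^sub>F z' in at z. z' \<in> {z. 0 < Im z}"
    using z open_halfspace_Im_gt[of 0] by (intro eventually_at_topological[THEN iffD2] exI[of _ "{z. 0 < Im z}"]) auto
  moreover have "\<forall>\<^sub>F z' in at z. dist z' z < (1 - \<rho>) * cmod z / 4"
    using \<rho> Z unfolding eventually_at by (intro exI[of _ "(1 - \<rho>) * cmod z / 4"]) auto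
  ultimately have "\<forall>\<^sub>F z' in at z. dist (W z') (W z) \<le> C * dist z' z"
    by eventually_elim (use * in auto)
  then show ?thesis by blast
qed

lemma W_tendsto:
  assumes z: "0 < Im z"
  shows "(W \<longlongrightarrow> W z) (at z)"
proof -
  obtain C where C: "\<forall>\<^sub>F z' in at z. dist (W z') (W z) \<le> C * dist z' z" using W_lipschitz[OF z] by blast
  have "((\<lambda>z'. C * dist z' z) \<longlongrightarrow> C * dist z z) (at z)" by (intro tendsto_intros)
  then have "((\<lambda>z'. dist (W z') (W z)) \<longlongrightarrow> 0) (at z)"
    by (intro tendsto_sandwich[OF _ C tendsto_const]) auto
  then show ?thesis by (rule tendsto_dist_iff[THEN iffD2])
qed

text \<open>Solved for the quotient, \<open>sol_diff\<close> expresses it as \<open>F\<close>,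
  continuous at z because |q z| < 1 by \<open>sol_contraction\<close> and
  \<open>sol_key\<close>.\<close>

lemma W_has_derivative:
  assumes z: "0 < Im z"
  shows "\<exists>d. (W has_field_derivative d) (at z)"
proof -
  have WT: "(W \<longlongrightarrow> W z) (at z)" by (rule W_tendsto[OF z])
  then have GT: "(G \<longlongrightarrow> G z) (at z)" unfolding G_def using k_pos by (intro tendsto_intros) auto
  note nz = sol_nonzero[OF sol_W[OF z]]
  define q where "q z' = (of_real k * (G z' * G z)) * (z' + a / (W z' * W z))" for z'
  have "cmod (q z) < 1"
    using sol_contraction[OF z z sol_W[OF z] sol_W[OF z]] sol_key[OF z sol_W[OF z]]
    by (simp add: q_def G_eq z)
  then have q: "q z \<noteq> 1" by auto
  have qT: "(q \<longlongrightarrow> q z) (at z)"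
    unfolding q_def by (intro tendsto_intros WT GT) (use nz in auto)
  define F where "F z' = of_real k * (G z' * G z) * W z / (1 - q z')" for z'
  have FT: "(F \<longlongrightarrow> F z) (at z)" unfolding F_def by (intro tendsto_intros qT GT) (use q in auto)
  have "\<forall>\<^sub>F z' in at z. q z' \<noteq> 1" using qT q by (rule tendsto_imp_eventually_ne)
  moreover have "\<forall>\<^sub>F z' in at z. z' \<in> {z. 0 < Im z}"
    using z open_halfspace_Im_gt[of 0] by (intro eventually_at_topological[THEN iffD2] exI[of _ "{z. 0 < Im z}"]) auto
  moreover have "\<forall>\<^sub>F z' in at z. z' \<noteq> z" by (simp add: eventually_at_filter)
  ultimately have "\<forall>\<^sub>F z' in at z. F z' = (W z' - W z) / (z' - z)"
  proof eventually_elim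
    case (elim z')
    have "(W z' - W z) * (1 - q z') = of_real k * (G z' * G z) * W z * (z' - z)"
      using sol_diff[OF sol_W sol_W[OF z], of z'] elim by (simp add: q_def G_eq z)
    then show ?case using elim by (simp add: F_def field_simps)
  qed
  then have "((\<lambda>z'. (W z' - W z) / (z' - z)) \<longlongrightarrow> F z) (at z)" by (rule Lim_transform_eventually[OF FT])
  then show ?thesis by (auto simp: has_field_derivative_iff)
qed

lemma holomorphic_G: "G holomorphic_on {z. 0 < Im z}"
proof -
  have "W holomorphic_on {z. 0 < Im z}"
    by (subst holomorphic_on_open) (auto simp: open_halfspace_Im_gt W_has_derivative)
  then show ?thesis unfolding G_def using k_pos by (intro holomorphic_intros) auto
qed

text \<open>For |z| >= 4k, \<open>G_bound\<close> gives k |G| <= 1/2, so |w| >= 1/2 and D has size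
  at least |z|/4. The second estimate uses G - 1/z = G (z - D)/z, where z - D = k z G + b + a/w is
  bounded.\<close>

lemma G_asymp:
  assumes z: "0 < Im z" and R: "4 * k \<le> cmod z" "4 * (b + 2 * a) \<le> cmod z" "1 \<le> cmod z"
  shows "cmod (G z) \<le> 4 / cmod z" "cmod (G z - 1 / z) \<le> (16 * k + 4 * (b + 2 * a)) / (cmod z)\<^sup>2"
proof -
  have Z: "0 < cmod z" using R by linarith
  have "(2 * (k * cmod (G z)))\<^sup>2 = (4 * k) * (k * (cmod (G z))\<^sup>2)" by (simp add: power2_eq_square)
  also have "\<dots> \<le> cmod z * (k * (cmod (G z))\<^sup>2)" using R k_pos by (intro mult_right_mono) auto
  also have "\<dots> \<le> 1" using G_bound[OF z] by (simp add: mult_ac)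
  finally have kG: "k * cmod (G z) \<le> 1 / 2" using power2_le_imp_le[of "2 * (k * cmod (G z))" 1] by simp
  have W: "1 / 2 \<le> cmod (W z)"
    unfolding W_eq_G using norm_triangle_ineq2[of 1 "k * G z"] kG k_pos by (simp add: norm_mult)
  then have aW: "cmod (a / W z) \<le> 2 * a" using a_pos by (simp add: norm_divide divide_le_eq mult.commute)
  have bW: "cmod (b + a / W z) \<le> b + 2 * a"
    using norm_triangle_ineq[of "complex_of_real b" "a / W z"] aW b_nonneg by simp
  have DD: "D z (W z) = z * W z - (b + a / W z)" by (simp add: D_def)
  have "cmod z * (1 / 2) - cmod z / 4 \<le> cmod z * cmod (W z) - cmod (b + a / W z)"
    using W bW R Z by (intro diff_mono mult_left_mono) auto
  also have "\<dots> \<le> cmod (D z (W z))" unfolding DD using norm_triangle_ineq2[of "z * W z" "b + a / W z"] by (simp add: norm_mult)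
  finally have "cmod z / 4 \<le> cmod (D z (W z))" by simp
  then have "1 / cmod (D z (W z)) \<le> 1 / (cmod z / 4)" using Z by (intro divide_left_mono mult_pos_pos) auto
  then show g: "cmod (G z) \<le> 4 / cmod z" by (simp add: G_eq z norm_divide)
  have "D z (W z) \<noteq> 0" using sol_nonzero[OF sol_W[OF z]] by simp
  then have "G z * D z (W z) = 1" by (simp add: G_eq z)
  then have "G z - 1 / z = G z * (z - D z (W z)) / z" using Z by (simp add: field_simps)
  also have "z - D z (W z) = z * (1 - W z) + (b + a / W z)" by (simp add: DD algebra_simps)
  also have "1 - W z = k * G z" by (simp add: W_eq_G)
  finally have "cmod (G z - 1 / z) = cmod (G z) * cmod (z * (k * G z) + (b + a / W z)) / cmod z"
    by (simp add: norm_mult norm_divide)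
  also have "cmod (z * (k * G z) + (b + a / W z)) \<le> cmod z * (k * cmod (G z)) + (b + 2 * a)"
    using k_pos by (intro order_trans[OF norm_triangle_ineq] add_mono[OF _ bW]) (auto simp: norm_mult)
  also have "\<dots> \<le> cmod z * (k * (4 / cmod z)) + (b + 2 * a)"
    using g k_pos by (intro add_mono mult_left_mono) auto
  also have "\<dots> = 4 * k + (b + 2 * a)" using Z by simp
  finally have "cmod (G z - 1 / z) \<le> cmod (G z) * (4 * k + (b + 2 * a)) / cmod z"
    by (simp add: mult_left_mono divide_right_mono)
  also have "\<dots> \<le> (4 / cmod z) * (4 * k + (b + 2 * a)) / cmod z"
    using g k_pos b_nonneg a_pos by (intro divide_right_mono mult_right_mono) auto
  finally show "cmod (G z - 1 / z) \<le> (16 * k + 4 * (b + 2 * a)) / (cmod z)\<^sup>2"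
    by (simp add: power2_eq_square algebra_simps add_divide_distrib)
qed

section \<open>Boundary behaviour of the solution\<close>

text \<open>Polymorphic because the intermediate value theorem is applied to it over the reals, the
  factorization over the complex numbers.\<close>

definition cubic :: "'a::{comm_ring_1,real_algebra_1} \<Rightarrow> 'a \<Rightarrow> 'a" where
  "cubic z w = z * w^3 - (of_real b + z) * w\<^sup>2 + of_real (b + k - a) * w + of_real a"

text \<open>The discriminant of the monic polynomial \<^term>\<open>cubic x\<close> / x, multiplied by x^4; it agrees with
  S for k = rt and b = t - rt.\<close>

definition disc :: "real \<Rightarrow> real" where
  "disc x = (let t = b + k in
     4*a*x^3 - (8*a^2 + 12*a*k + 8*a*t - t^2)*x^2
     + 2*(2*a^3 - 10*a^2*k + 4*a^2*t + 6*a*k^2 - a*k*t + a*t^2 - k*t^2 - t^3)*x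
     + b^2*(a^2 - 4*a*k + 2*a*t + t^2))"

lemma sol_cubic:
  assumes w: "sol z w" shows "cubic z w = 0"
proof -
  note nz = sol_nonzero[OF w]
  have "k = (1 - w) * D z w" using sol_eq[OF w] nz by (simp add: field_simps)
  then have "k * w = (1 - w) * (z * w\<^sup>2 - b * w - a)"
    using nz by (simp add: D_def power2_eq_square field_simps)
  then show ?thesis by (simp add: cubic_def power2_eq_square power3_eq_cube algebra_simps)
qed

text \<open>The cubic is a > 0 at 0 and tends to minus infinity at minus infinity, hence has a
  negative root. The equations compare coefficients with x (w - w0)(w^2 + \<beta> w +
  \<gamma>).\<close>

lemma cubic_factor:
  assumes x: "0 < x"
  obtains w0 \<beta> \<gamma> :: real where "w0 < 0"
    and "b + x = x * (w0 - \<beta>)" "b + k - a = x * (\<gamma> - w0 * \<beta>)" "a = - x * w0 * \<gamma>"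
proof -
  have "\<exists>w<0. cubic x w < 0"
  proof -
    have "filterlim (\<lambda>w::real. cubic x w) at_bot at_bot"
      unfolding cubic_def of_real_eq_id id_apply using x by real_asymp
    then have "eventually (\<lambda>w. cubic x w < 0) at_bot" by (simp add: filterlim_at_bot_dense)
    then have "eventually (\<lambda>w. cubic x w < 0 \<and> w < 0) at_bot" by (intro eventually_conj eventually_gt_at_bot)
    then show ?thesis by (metis (no_types, lifting) eventually_at_bot_linorder order_refl)
  qed
  then obtain m where m: "m < 0" "cubic x m < 0" by blast
  have "0 < cubic x 0" using a_pos by (simp add: cubic_def)
  then obtain w0 where w0: "m \<le> w0" "w0 \<le> 0" "cubic x w0 = 0"
    using IVT'[of "cubic x" m 0 0] m by (force simp: cubic_def intro!: continuous_intros)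
  have w0neg: "w0 < 0" using w0 \<open>0 < cubic x 0\<close> by (cases "w0 = 0") auto
  define \<beta> where "\<beta> = w0 - (b + x) / x"
  define \<gamma> where "\<gamma> = (b + k - a) / x + w0 * \<beta>"
  have 1: "b + x = x * (w0 - \<beta>)" using x by (simp add: \<beta>_def)
  have 2: "b + k - a = x * (\<gamma> - w0 * \<beta>)" using x by (simp add: \<gamma>_def)
  have "x * w0^3 - (b + x) * w0\<^sup>2 + (b + k - a) * w0 + a = 0" using w0(3) by (simp add: cubic_def)
  then have "a = - x * w0 * \<gamma>" unfolding 1 2
    by (simp add: power2_eq_square power3_eq_cube algebra_simps)
  with w0neg 1 2 show ?thesis using that by blast
qed

text \<open>The discriminant of (w - w0) Q(w) is Q(w0)^2 times that of Q. Thus the sign of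
  \<open>disc\<close> tells whether the two remaining roots are real or conjugate.\<close>

lemma disc_factor:
  fixes w0 \<beta> \<gamma> x :: real
  assumes "b + x = x * (w0 - \<beta>)" "b + k - a = x * (\<gamma> - w0 * \<beta>)" "a = - x * w0 * \<gamma>"
  shows "disc x = x^4 * (w0\<^sup>2 + \<beta> * w0 + \<gamma>)\<^sup>2 * (\<beta>\<^sup>2 - 4 * \<gamma>)"
proof -
  have b: "b = x * (w0 - \<beta>) - x" using assms(1) by simp
  have a: "a = - x * w0 * \<gamma>" using assms(3) .
  have k: "k = x * (\<gamma> - w0 * \<beta>) - x * w0 * \<gamma> - x * (w0 - \<beta>) + x" using assms by simp
  show ?thesis unfolding disc_def Let_def unfolding a b k by algebra
qed

lemma cubic_factored:
  fixes w :: complex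
  assumes "b + x = x * (w0 - \<beta>)" "b + k - a = x * (\<gamma> - w0 * \<beta>)" "a = - x * w0 * \<gamma>"
  shows "cubic (of_real x) w = of_real x * (w - of_real w0) * (w\<^sup>2 + of_real \<beta> * w + of_real \<gamma>)"
proof -
  have "cubic (of_real x) w = of_real x * w^3 - of_real (b + x) * w\<^sup>2 + of_real (b + k - a) * w + of_real a"
    by (simp add: cubic_def)
  then show ?thesis unfolding assms(1,2) using arg_cong[OF assms(3), of complex_of_real]
    by (simp add: power2_eq_square power3_eq_cube algebra_simps)
qed

lemma W_bound:
  assumes x: "x \<noteq> 0" and h: "0 < h"
  shows "cmod (W (Complex x h)) \<le> 1 + sqrt (k / \<bar>x\<bar>)"
proof -
  let ?z = "Complex x h"
  have "(k * cmod (G ?z))\<^sup>2 * \<bar>x\<bar> \<le> (k * cmod (G ?z))\<^sup>2 * cmod ?z"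
    using abs_Re_le_cmod[of ?z] by (intro mult_left_mono) auto
  also have "\<dots> = k * (k * (cmod (G ?z))\<^sup>2 * cmod ?z)" by (simp add: power2_eq_square)
  also have "\<dots> \<le> k * 1" using G_bound[of ?z] h k_pos by (intro mult_left_mono) auto
  finally have "(k * cmod (G ?z))\<^sup>2 \<le> k / \<bar>x\<bar>" using x by (simp add: field_simps)
  then have "k * cmod (G ?z) \<le> sqrt (k / \<bar>x\<bar>)" by (rule real_le_rsqrt)
  then show ?thesis unfolding W_eq_G
    using norm_triangle_ineq4[of 1 "k * G ?z"] k_pos by (simp add: norm_mult)
qed

lemma W_sol_facts:
  assumes "0 < h"
  shows "0 < Im (W (Complex x h))" "0 < x * Im (W (Complex x h)) + h * Re (W (Complex x h))"
  using sol_W[of "Complex x h"] assms by (auto simp: sol_def)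

text \<open>The cubic is affine in z, so replacing x + i h by x changes its value by h |w^3 - w^2|,
  and w is bounded uniformly in h.\<close>

lemma cubic_W_bound:
  assumes x: "x \<noteq> 0"
  obtains C where "0 < C" "\<And>h. 0 < h \<Longrightarrow> cmod (cubic (of_real x) (W (Complex x h))) \<le> C * h"
proof -
  define M where "M = 1 + sqrt (k / \<bar>x\<bar>)"
  have M: "0 < M" using k_pos x by (simp add: M_def add_pos_nonneg)
  have "cmod (cubic (of_real x) (W (Complex x h))) \<le> (M^3 + M^2) * h" if h: "0 < h" for h
  proof -
    define w where "w = W (Complex x h)"
    have w: "cmod w \<le> M" using W_bound[OF x h] by (simp add: M_def w_def)
    have "cubic (of_real x) w = cubic (of_real x) w - cubic (Complex x h) w"
      using sol_cubic[OF sol_W] h by (simp add: w_def)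
    also have "\<dots> = - \<i> * of_real h * (w^3 - w^2)"
      by (simp add: cubic_def Complex_eq algebra_simps)
    also have "cmod \<dots> = h * cmod (w^3 - w^2)" using h by (simp add: norm_mult)
    also have "\<dots> \<le> h * (M^3 + M^2)"
      using h w by (intro mult_left_mono order_trans[OF norm_triangle_ineq4] add_mono)
        (auto simp: norm_power power_mono)
    finally show ?thesis by (simp add: w_def mult.commute)
  qed
  moreover have "0 < M^3 + M^2" using M by (simp add: add_pos_pos)
  ultimately show ?thesis using that by blast
qed

text \<open>For negative x the cone condition Im (z w) > 0 reads |x| Im w < h Re w, and Re w stays
  bounded.\<close>

lemma boundary_neg:
  assumes x: "x < 0"
  shows "((\<lambda>h. Im (W (Complex x h))) \<longlongrightarrow> 0) (at_right 0)"
proof (rule tendsto_sandwich)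
  define M where "M = 1 + sqrt (k / \<bar>x\<bar>)"
  show "\<forall>\<^sub>F h in at_right 0. 0 \<le> Im (W (Complex x h))"
    using eventually_at_right_less[of 0] by eventually_elim (use W_sol_facts(1) in \<open>auto intro: less_imp_le\<close>)
  show "\<forall>\<^sub>F h in at_right 0. Im (W (Complex x h)) \<le> h * M / - x"
    using eventually_at_right_less[of 0]
  proof eventually_elim
    case (elim h)
    have "h * Re (W (Complex x h)) \<le> h * M"
      using W_bound[of x h] complex_Re_le_cmod[of "W (Complex x h)"] x elim
      by (intro mult_left_mono) (auto simp: M_def)
    then have "Im (W (Complex x h)) * (- x) \<le> h * M" using W_sol_facts(2)[OF elim, of x] by (simp add: algebra_simps)
    then show ?case using x by (subst pos_le_divide_eq) auto
  qed
  have "((\<lambda>h. h * M / - x) \<longlongrightarrow> 0 * M / - x) (at_right 0)" by (intro tendsto_intros) (use x in auto)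
  then show "((\<lambda>h. h * M / - x) \<longlongrightarrow> 0) (at_right 0)" by simp
qed simp

text \<open>All three roots are real, so Im w is at most the distance from w to each of them, and
  its cube is O(h). Which root W approaches need not be decided.\<close>

lemma boundary_disc_pos:
  assumes x: "0 < x" and d: "0 < disc x"
  shows "((\<lambda>h. Im (W (Complex x h))) \<longlongrightarrow> 0) (at_right 0)"
proof -
  obtain w0 \<beta> \<gamma> where f: "b + x = x * (w0 - \<beta>)" "b + k - a = x * (\<gamma> - w0 * \<beta>)" "a = - x * w0 * \<gamma>"
    using cubic_factor[OF x] by blast
  have D: "0 < \<beta>\<^sup>2 - 4 * \<gamma>" using d unfolding disc_factor[OF f]
    by (smt (verit, best) mult_nonneg_nonpos zero_le_even_power even_numeral zero_le_power2 mult_nonneg_nonneg)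
  define s where "s = sqrt (\<beta>\<^sup>2 - 4 * \<gamma>)"
  have s: "s\<^sup>2 = \<beta>\<^sup>2 - 4 * \<gamma>" using D by (simp add: s_def)
  define r1 r2 where "r1 = (- \<beta> + s) / 2" and "r2 = (- \<beta> - s) / 2"
  have r: "r1 + r2 = - \<beta>" "r1 * r2 = \<gamma>"
    using s by (simp_all add: r1_def r2_def power2_eq_square field_simps)
  have quad: "w\<^sup>2 + of_real \<beta> * w + of_real \<gamma> = (w - of_real r1) * (w - of_real r2)" for w :: complex
  proof -
    have "complex_of_real \<beta> = - (of_real r1 + of_real r2)" using r(1) by (metis of_real_add of_real_minus minus_minus)
    moreover have "complex_of_real \<gamma> = of_real r1 * of_real r2" using r(2) by auto
    ultimately show ?thesis by (simp only:) (simp add: power2_eq_square algebra_simps)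
  qed
  obtain C where C: "0 < C" "\<And>h. 0 < h \<Longrightarrow> cmod (cubic (of_real x) (W (Complex x h))) \<le> C * h"
    using cubic_W_bound[of x] x by auto
  show ?thesis
  proof (rule tendsto_sandwich)
    show "\<forall>\<^sub>F h in at_right 0. 0 \<le> Im (W (Complex x h))"
      using eventually_at_right_less[of 0] by eventually_elim (use W_sol_facts(1) in \<open>auto intro: less_imp_le\<close>)
    show "\<forall>\<^sub>F h in at_right 0. Im (W (Complex x h)) \<le> root 3 (C * h / x)"
      using eventually_at_right_less[of 0]
    proof eventually_elim
      case (elim h)
      define w where "w = W (Complex x h)"
      have w: "0 < Im w" using W_sol_facts(1)[OF elim] by (simp add: w_def)
      have le: "Im w \<le> cmod (w - of_real c)" for c using abs_Im_le_cmod[of "w - of_real c"] by simp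
      have "x * (Im w * (Im w * Im w)) \<le> x * (cmod (w - w0) * (cmod (w - r1) * cmod (w - r2)))"
        using x w by (intro mult_left_mono mult_mono le) auto
      also have "\<dots> = cmod (cubic (of_real x) w)"
        unfolding cubic_factored[OF f] quad using x by (simp add: norm_mult mult.assoc)
      also have "\<dots> \<le> C * h" using C(2)[OF elim] by (simp add: w_def)
      finally have "(Im w)^3 \<le> C * h / x" using x by (simp add: field_simps power3_eq_cube)
      moreover have "Im w = root 3 ((Im w)^3)" using w by (simp add: real_root_power_cancel)
      ultimately show ?case unfolding w_def[symmetric] by (metis real_root_le_iff zero_less_numeral)
    qed
    have "((\<lambda>h. root 3 (C * h / x)) \<longlongrightarrow> root 3 (C * 0 / x)) (at_right 0)" by (intro tendsto_intros) (use x in auto)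
    then show "((\<lambda>h. root 3 (C * h / x)) \<longlongrightarrow> 0) (at_right 0)" by simp
  qed simp
qed

text \<open>A product of three distances is O(h). The distance to \<open>cnj w1\<close> is at least
  q because Im W > 0, and once the distance to w0 is bounded below the distance to w1 = p + i q must
  vanish in the limit.\<close>

lemma boundary_disc_neg:
  assumes x: "0 < x" and d: "disc x < 0"
  obtains w0 p q :: real where "w0 < 0" "0 < q"
    "b + x = x * (w0 + 2 * p)" "b + k - a = x * (p\<^sup>2 + q\<^sup>2 + 2 * w0 * p)" "a = - x * w0 * (p\<^sup>2 + q\<^sup>2)"
    "((\<lambda>h. Im (W (Complex x h))) \<longlongrightarrow> q) (at_right 0)"
proof -
  obtain w0 \<beta> \<gamma> where w0: "w0 < 0"
    and f: "b + x = x * (w0 - \<beta>)" "b + k - a = x * (\<gamma> - w0 * \<beta>)" "a = - x * w0 * \<gamma>"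
    using cubic_factor[OF x] by blast
  have D: "\<beta>\<^sup>2 - 4 * \<gamma> < 0" using d unfolding disc_factor[OF f]
    by (smt (verit, best) mult_nonneg_nonneg zero_le_even_power even_numeral zero_le_power2)
  define p q where "p = - \<beta> / 2" and "q = sqrt (4 * \<gamma> - \<beta>\<^sup>2) / 2"
  have q: "0 < q" "q\<^sup>2 = \<gamma> - \<beta>\<^sup>2 / 4" using D by (auto simp: q_def power_divide)
  have \<beta>: "\<beta> = - 2 * p" by (simp add: p_def)
  have \<gamma>: "\<gamma> = p\<^sup>2 + q\<^sup>2" using q by (simp add: p_def power_divide)
  define w1 where "w1 = Complex p q"
  have quad: "w\<^sup>2 + of_real \<beta> * w + of_real \<gamma> = (w - w1) * (w - cnj w1)" for w :: complex
    unfolding \<beta> \<gamma> w1_def by (simp add: complex_eq_iff power2_eq_square algebra_simps)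
  obtain C where C: "0 < C" "\<And>h. 0 < h \<Longrightarrow> cmod (cubic (of_real x) (W (Complex x h))) \<le> C * h"
    using cubic_W_bound[of x] x by auto

  \<comment> \<open>The real root w0 is excluded as a limit: in terms of y = zw the cubic reads
    F(z, y) = a z^2 - z y^2 + (t - a) z y + y^2 (y - b) = 0, and Im F = h A + (Im y) B with A, B
    positive near (x, x w0), which contradicts Im y > 0.\<close>
  define t where "t = b + k"
  define y where "y h w = (of_real x + \<i> * of_real h) * w" for h :: real and w :: complex
  define A where "A h w = 2*a*x - (Re (y h w))\<^sup>2 + (Im (y h w))\<^sup>2 + (t-a) * Re (y h w)" for h w
  define B where "B h w = - 2 * x * Re (y h w) + (t-a)*x + 3 * (Re (y h w))\<^sup>2 - 2*b*Re (y h w) - (Im (y h w))\<^sup>2" for h w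
  define s where "s = x * w0"
  have s: "s < 0" using x w0 by (simp add: s_def mult_pos_neg)
  have y0: "Re (y 0 w0) = s" "Im (y 0 w0) = 0" by (simp_all add: y_def s_def)
  \<comment> \<open>The cubic at w0 times x^2, rewritten in s = x w0; it replaces terms of unclear
    sign in \<open>A0\<close> and \<open>B0\<close>.\<close>
  have F: "a * x\<^sup>2 - x * s\<^sup>2 + (t - a) * x * s = s\<^sup>2 * (b - s)"
  proof -
    have b: "b = x * (w0 - \<beta>) - x" using f(1) by simp
    have ta: "t - a = x * (\<gamma> - w0 * \<beta>)" using f(2) by (simp add: t_def)
    show ?thesis unfolding ta b s_def by (subst f(3)) algebra
  qed
  have A0: "0 < A 0 w0"
  proof -
    have "x * (A 0 w0 - a * x) = s\<^sup>2 * (b - s)"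
      unfolding F[symmetric] A_def y0 by (simp add: power2_eq_square algebra_simps)
    moreover have "0 < s\<^sup>2 * (b - s)" using s b_nonneg by simp
    ultimately have "0 < A 0 w0 - a * x" using x by (metis zero_less_mult_pos)
    moreover have "0 < a * x" using a_pos x by simp
    ultimately show ?thesis by linarith
  qed
  \<comment> \<open>For a <= t every term is nonnegative. For a > t the sign of (t - a) x is wrong,
    and \<open>F\<close> rewrites s B so that every term is nonpositive.\<close>
  have B0: "0 < B 0 w0"
  proof (cases "a \<le> t")
    case True
    have "0 < 3 * s\<^sup>2" using s by simp
    moreover have "0 \<le> - 2 * x * s" "0 \<le> - 2 * b * s" "0 \<le> (t - a) * x"
      using x s b_nonneg True by (auto simp: mult_nonneg_nonpos mult_nonneg_nonpos2)
    ultimately show ?thesis unfolding B_def y0 zero_power2 by linarith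
  next
    case False
    have "s * B 0 w0 = s^3 + (a - t) * x * s - 2 * a * x\<^sup>2"
      using F unfolding B_def y0 by (simp add: power2_eq_square power3_eq_cube algebra_simps)
    moreover have "s^3 < 0" using s by simp
    moreover have "(a - t) * x * s \<le> 0" using False x s by (intro mult_nonneg_nonpos) auto
    moreover have "0 \<le> 2 * a * x\<^sup>2" using a_pos by simp
    ultimately have "s * B 0 w0 < 0" by linarith
    then show ?thesis using s by (simp add: mult_less_0_iff)
  qed
  have key: "h * A h w + Im (y h w) * B h w = 0" if "h > 0" "w = W (Complex x h)" for h w
  proof -
    define z where "z = Complex x h"
    have z: "z = of_real x + \<i> * of_real h" by (simp add: z_def Complex_eq)
    have "z\<^sup>2 * cubic z w = 0" using sol_cubic[OF sol_W[of z]] that by (simp add: z_def)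
    then have "a * z\<^sup>2 - z * (y h w)\<^sup>2 + (t - a) * z * y h w + (y h w)\<^sup>2 * (y h w - b) = 0"
      unfolding y_def z[symmetric] cubic_def t_def by (simp add: power2_eq_square power3_eq_cube algebra_simps)
    then have "Im (a * z\<^sup>2 - z * (y h w)\<^sup>2 + (t - a) * z * y h w + (y h w)\<^sup>2 * (y h w - b)) = 0" by simp
    then show ?thesis unfolding A_def B_def z_def
      by (simp add: power2_eq_square algebra_simps)
  qed
  have contA: "isCont (\<lambda>v. A (fst v) (snd v)) (0, of_real w0)" and contB: "isCont (\<lambda>v. B (fst v) (snd v)) (0, of_real w0)"
    unfolding A_def B_def y_def isCont_def by (intro tendsto_intros)+
  have "\<forall>\<^sub>F v in nhds (0, of_real w0). 0 < A (fst v) (snd v) \<and> 0 < B (fst v) (snd v)"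
    using contA contB A0 B0 unfolding continuous_at tendsto_nhds_iff[symmetric]
    by (intro eventually_conj) (auto dest!: order_tendstoD(1) simp: tendsto_nhds_iff eventually_nhds_conv_at isCont_def)
  then obtain d where d: "0 < d" "\<And>h w. dist (h, w) (0, of_real w0) < d \<Longrightarrow> 0 < A h w \<and> 0 < B h w"
    unfolding eventually_nhds_metric by fastforce
  have away: "d / 2 \<le> cmod (W (Complex x h) - w0)" if h: "0 < h" "h < d / 2" for h
  proof (rule ccontr)
    assume *: "\<not> ?thesis"
    define w where "w = W (Complex x h)"
    have "dist (h, w) (0, of_real w0) \<le> \<bar>h\<bar> + cmod (w - w0)"
      unfolding dist_prod_def dist_norm using sqrt_sum_squares_le_sum_abs[of h "cmod (w - w0)"] by simp
    also have "\<dots> < d" using * h by (simp add: w_def)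
    finally have "0 < A h w" "0 < B h w" using d(2) by blast+
    moreover have "0 < Im (y h w)" using W_sol_facts(2)[OF h(1), of x] by (simp add: y_def w_def algebra_simps)
    ultimately have "0 < h * A h w + Im (y h w) * B h w" using h by (simp add: add_pos_pos)
    then show False using key[OF h(1) w_def] by simp
  qed
  have ev: "\<forall>\<^sub>F h in at_right 0. 0 < h \<and> h < d / 2"
    using d(1) by (intro eventually_at_rightI[of 0 "d / 2"]) auto
  have "((\<lambda>h. W (Complex x h)) \<longlongrightarrow> w1) (at_right 0)"
  proof (rule tendsto_dist_iff[THEN iffD2], rule tendsto_sandwich[where f="\<lambda>_. 0"])
    show "\<forall>\<^sub>F h in at_right 0. dist (W (Complex x h)) w1 \<le> C * h / (x * (d / 2) * q)"
      using ev
    proof eventually_elim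
      case (elim h)
      define w where "w = W (Complex x h)"
      have "q \<le> cmod (w - cnj w1)"
        using abs_Im_le_cmod[of "w - cnj w1"] W_sol_facts(1)[of h x] elim q by (simp add: w_def w1_def)
      then have "x * (d / 2) * q * cmod (w - w1) \<le> x * cmod (w - w0) * cmod (w - cnj w1) * cmod (w - w1)"
        using away[of h] elim x q d(1) by (intro mult_right_mono mult_mono) (auto simp: w_def)
      also have "\<dots> = cmod (cubic (of_real x) w)"
        unfolding cubic_factored[OF f] quad using x by (simp add: norm_mult)
      also have "\<dots> \<le> C * h" using C(2)[of h] elim by (simp add: w_def)
      finally show ?case using x q d by (simp add: dist_norm w_def field_simps)
    qed
    have "((\<lambda>h. C * h / (x * (d / 2) * q)) \<longlongrightarrow> C * 0 / (x * (d / 2) * q)) (at_right 0)"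
      by (intro tendsto_intros) (use x q d in auto)
    then show "((\<lambda>h. C * h / (x * (d / 2) * q)) \<longlongrightarrow> 0) (at_right 0)" by simp
  qed auto
  then have "((\<lambda>h. Im (W (Complex x h))) \<longlongrightarrow> Im w1) (at_right 0)" by (rule tendsto_Im)
  then show ?thesis using that[of w0 q p] w0 q f unfolding \<beta> \<gamma> by (simp add: w1_def)
qed

section \<open>The measure with Stieltjes transform G\<close>

lemma Im_G: "Im (G z) = - Im (W z) / k"
  by (simp add: G_def Im_divide_of_real)

text \<open>\<open>G_bound\<close> serves |x| <= 1 and \<open>G_asymp\<close> serves |x| >= R, where
  h <= 1 enters through |Im (1/z)| = h/|z|^2. In between the bound 1/sqrt k is traded for R^2/x^2.
  The constant c covers all three ranges.\<close>

lemma G_majorant: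
  obtains c where "0 < c" "\<And>x h. x \<noteq> 0 \<Longrightarrow> 0 < h \<Longrightarrow> h \<le> 1 \<Longrightarrow> \<bar>Im (G (Complex x h))\<bar> \<le> c * power_majorant x"
proof -
  define R where "R = 4 * k + 4 * (b + 2 * a) + 1"
  define C where "C = 16 * k + 4 * (b + 2 * a)"
  define c where "c = (1 + R\<^sup>2) / sqrt k + (1 + C)"
  have R: "1 \<le> R" and C: "0 \<le> C" using k_pos a_pos b_nonneg by (auto simp: R_def C_def)
  have "0 \<le> (1 + R\<^sup>2) / sqrt k" using k_pos by simp
  then have c: "0 < c" unfolding c_def using C by linarith
  have main: "\<bar>Im (G (Complex x h))\<bar> \<le> c * power_majorant x" if x: "x \<noteq> 0" and h: "0 < h" "h \<le> 1" for x h
  proof -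
    define z where "z = Complex x h"
    have z: "0 < Im z" using h by (simp add: z_def)
    have xz: "\<bar>x\<bar> \<le> cmod z" using abs_Re_le_cmod[of z] by (simp add: z_def)
    have "k * (cmod (G z))\<^sup>2 * \<bar>x\<bar> \<le> k * (cmod (G z))\<^sup>2 * cmod z" using xz k_pos by (intro mult_left_mono) auto
    then have "(cmod (G z))\<^sup>2 * (k * \<bar>x\<bar>) \<le> 1" using G_bound[OF z] by (simp add: mult_ac)
    then have "(cmod (G z))\<^sup>2 \<le> 1 / (k * \<bar>x\<bar>)" using k_pos x by (subst pos_le_divide_eq) auto
    then have "cmod (G z) \<le> sqrt (1 / (k * \<bar>x\<bar>))" by (rule real_le_rsqrt)
    then have "cmod (G z) \<le> 1 / sqrt k / sqrt \<bar>x\<bar>"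
      by (simp add: real_sqrt_divide real_sqrt_mult)
    then have near: "\<bar>Im (G z)\<bar> \<le> 1 / sqrt k / sqrt \<bar>x\<bar>" using abs_Im_le_cmod[of "G z"] by linarith
    have pm: "\<bar>x\<bar> powr (-1/2) = 1 / sqrt \<bar>x\<bar>" "\<bar>x\<bar> powr (-2) = 1 / x\<^sup>2"
      using x powr_minus_divide[of "\<bar>x\<bar>" "1/2"] powr_minus_divide[of "\<bar>x\<bar>" "2"] by (simp_all add: powr_half_sqrt)
    have maj: "0 \<le> power_majorant x" by (simp add: power_majorant_def)
    consider "\<bar>x\<bar> \<le> 1" | "1 \<le> \<bar>x\<bar>" "\<bar>x\<bar> \<le> R" | "R \<le> \<bar>x\<bar>" by linarith
    then have "\<bar>Im (G z)\<bar> \<le> c * power_majorant x"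
    proof cases
      case 1
      have "1 / sqrt k \<le> c" unfolding c_def using k_pos C by (simp add: add_divide_distrib add_increasing2)
      then have "1 / sqrt k / sqrt \<bar>x\<bar> \<le> c * (1 / sqrt \<bar>x\<bar>)"
        using mult_right_mono[of "1 / sqrt k" c "1 / sqrt \<bar>x\<bar>"] by simp
      also have "1 / sqrt \<bar>x\<bar> \<le> power_majorant x" using 1 x pm by (simp add: power_majorant_def)
      finally show ?thesis using near c by (simp add: mult_left_mono)
    next
      case 2
      have "1 / sqrt k / sqrt \<bar>x\<bar> \<le> 1 / sqrt k / 1" using 2 k_pos by (intro divide_left_mono) auto
      also have "\<dots> \<le> 1 / sqrt k * (R\<^sup>2 / x\<^sup>2)"
      proof -
        have "x\<^sup>2 \<le> R\<^sup>2" using 2 R abs_le_square_iff[of x R] by simp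
        then have "1 \<le> R\<^sup>2 / x\<^sup>2" using x by simp
        from mult_left_mono[OF this, of "1 / sqrt k"] show ?thesis using k_pos by simp
      qed
      also have "\<dots> = R\<^sup>2 / sqrt k * (1 / x\<^sup>2)" by simp
      also have "\<dots> \<le> c * (1 / x\<^sup>2)"
        unfolding c_def using k_pos C by (intro mult_right_mono) (auto simp: add_divide_distrib)
      also have "1 / x\<^sup>2 \<le> power_majorant x" using 2 pm by (simp add: power_majorant_def)
      finally show ?thesis using near c by (simp add: mult_left_mono)
    next
      case 3
      have Z: "4 * k \<le> cmod z" "4 * (b + 2 * a) \<le> cmod z" "1 \<le> cmod z"
        using 3 xz k_pos a_pos b_nonneg unfolding R_def by simp_all
      have x2: "x\<^sup>2 \<le> (cmod z)\<^sup>2" using xz by (metis abs_le_square_iff abs_norm_cancel)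
      have x0: "0 < x\<^sup>2" using x by simp
      have "\<bar>Im (G z)\<bar> \<le> \<bar>Im (G z - 1 / z)\<bar> + \<bar>Im (1 / z)\<bar>" by simp
      also have "\<bar>Im (G z - 1 / z)\<bar> \<le> C / (cmod z)\<^sup>2"
        using G_asymp(2)[OF z Z] abs_Im_le_cmod[of "G z - 1 / z"] unfolding C_def by linarith
      also have "\<bar>Im (1 / z)\<bar> = h / (cmod z)\<^sup>2"
        using h by (simp add: Im_divide cmod_power2 z_def abs_div)
      also have "C / (cmod z)\<^sup>2 + h / (cmod z)\<^sup>2 \<le> C / x\<^sup>2 + 1 / x\<^sup>2"
        using x2 x0 C h by (intro add_mono frac_le) auto
      also have "\<dots> = (1 + C) * (1 / x\<^sup>2)" by (simp add: add_divide_distrib)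
      also have "\<dots> \<le> c * (1 / x\<^sup>2)" unfolding c_def using k_pos by (intro mult_right_mono) auto
      also have "1 / x\<^sup>2 \<le> power_majorant x" using 3 R pm by (simp add: power_majorant_def)
      finally show ?thesis using c by (simp add: mult_left_mono)
    qed
    then show ?thesis by (simp add: z_def)
  qed
  show ?thesis by (rule that[OF c main])
qed

text \<open>The cone conditions come from the kernel: 1/(z - y) has negative imaginary part, and Im
  (z/(z - y)) = - h y/|z - y|^2 <= 0 for y >= 0. Then \<open>sol_unique\<close> applies.\<close>

lemma stieltjes_transform_sol:
  assumes M: "real_distribution M" and nonneg: "AE y in M. 0 \<le> y"
    and z: "0 < Im z"
    and eq: "let g = stieltjes M z; w = 1 - of_real k * g in z = 1 / g + of_real (b + k) / w + of_real a / w\<^sup>2"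
  shows "stieltjes M z = G z"
proof -
  interpret real_distribution M by fact
  define g w where "g = stieltjes M z" and "w = 1 - of_real k * g"
  define x h where "x = Re z" and "h = Im z"
  have zx: "z = Complex x h" and h: "0 < h" using z by (simp_all add: x_def h_def)
  have pos: "0 < (x - y)\<^sup>2 + h\<^sup>2" for y using h by (simp add: add_nonneg_pos)
  have int: "integrable M (\<lambda>y. 1 / (z - of_real y))" using Im_stieltjes(2)[OF M h, of x] by (simp add: zx)
  have int2: "integrable M (\<lambda>y. h / ((x - y)\<^sup>2 + h\<^sup>2))"
  proof -
    have "integrable M (\<lambda>y. - Im (1 / (z - of_real y)))" using int by simp
    also have "(\<lambda>y. - Im (1 / (z - of_real y))) = (\<lambda>y. h / ((x - y)\<^sup>2 + h\<^sup>2))"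
      by (simp add: fun_eq_iff zx Im_divide)
    finally show ?thesis .
  qed
  have "0 < (LINT y|M. h / ((x - y)\<^sup>2 + h\<^sup>2))"
    using int2 h pos by (intro expectation_greater) auto
  then have gneg: "Im g < 0" unfolding g_def zx Im_stieltjes(1)[OF M h] by simp
  have w: "0 < Im w" using gneg k_pos by (simp add: w_def mult_pos_neg)
  have zg: "Im (z * g) \<le> 0"
  proof -
    have "z * g = (LINT y|M. z * (1 / (z - of_real y)))"
      unfolding g_def stieltjes_def by (rule Bochner_Integration.integral_mult_right[symmetric]) (rule int)
    moreover have int': "integrable M (\<lambda>y. z * (1 / (z - of_real y)))"
      using int by (rule Bochner_Integration.integrable_mult_right)
    ultimately have "Im (z * g) = (LINT y|M. Im (z * (1 / (z - of_real y))))"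
      by (simp only: integral_Im[OF int'])
    also have "\<dots> \<le> (LINT y|M. 0)"
    proof (rule integral_mono_AE)
      show "AE y in M. Im (z * (1 / (z - of_real y))) \<le> 0"
        using nonneg
      proof eventually_elim
        case (elim y)
        have "Im (z * (1 / (z - of_real y))) = - (h * y) / ((x - y)\<^sup>2 + h\<^sup>2)"
          by (simp add: zx Im_divide algebra_simps)
        moreover have "0 \<le> h * y / ((x - y)\<^sup>2 + h\<^sup>2)" using elim h pos[of y] by simp
        ultimately show ?case by simp
      qed
    qed (rule integrable_Im[OF int'], simp)
    finally show ?thesis by simp
  qed
  have zw: "0 < Im (z * w)"
  proof -
    have "Im (z * w) = Im z - k * Im (z * g)" by (simp add: w_def algebra_simps)
    moreover have "k * Im (z * g) \<le> 0" using zg k_pos by (simp add: mult_nonneg_nonpos)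
    ultimately show ?thesis using z by linarith
  qed
  have g0: "g \<noteq> 0" and w0: "w \<noteq> 0" using gneg w by auto
  have "z = 1 / g + of_real (b + k) / w + of_real a / w\<^sup>2" using eq by (simp add: Let_def g_def w_def)
  then have "z * w = (1 / g) * w + of_real (b + k) + of_real a / w"
    using w0 by (simp add: field_simps power2_eq_square)
  also have "(1 / g) * w = 1 / g - of_real k" using g0 by (simp add: w_def field_simps)
  finally have "D z w = 1 / g" by (simp add: D_def)
  then have "w = T z w" by (simp add: T_def w_def)
  then have "sol z w" using w zw by (simp add: sol_def)
  then have "w = W z" using sol_unique[OF z _ sol_W[OF z]] by blast
  then have "of_real k * g = of_real k * G z" unfolding W_eq_G by (simp add: w_def)
  then show ?thesis using k_pos by (simp add: g_def)
qed


text \<open>\<open>S\<close> collects points where no boundary limit is claimed; being finite, it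
  affects neither measurability nor integrals.\<close>

lemma boundary_density:
  fixes \<rho> :: "real \<Rightarrow> real"
  assumes S: "finite S" and nonneg: "\<And>x. 0 \<le> \<rho> x"
    and lim: "\<And>x. x \<notin> S \<Longrightarrow> ((\<lambda>h. Im (G (Complex x h))) \<longlongrightarrow> - pi * \<rho> x) (at_right 0)"
  shows "\<rho> \<in> borel_measurable borel"
    and "real_distribution (density lborel (\<lambda>x. ennreal (\<rho> x)))"
    and "\<And>z. 0 < Im z \<Longrightarrow> stieltjes (density lborel (\<lambda>x. ennreal (\<rho> x))) z = G z"
proof -
  have fl: "filterlim (\<lambda>n. 1 / real (Suc n)) (at_right 0) sequentially"
    unfolding filterlim_at by (auto intro!: LIMSEQ_Suc[OF lim_1_over_n] simp del: of_nat_Suc)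
  have meas: "(\<lambda>x. Im (G (Complex x h))) \<in> borel_measurable borel" if "0 < h" for h
  proof -
    have "continuous_on UNIV (\<lambda>x. G (of_real x + \<i> * of_real h))"
      by (rule continuous_on_compose2[OF holomorphic_on_imp_continuous_on[OF holomorphic_G]])
        (use that in \<open>auto intro!: continuous_intros\<close>)
    then show ?thesis by (intro borel_measurable_continuous_onI continuous_intros) (simp add: Complex_eq)
  qed
  have "(\<lambda>x. if x \<in> S then 0 else \<rho> x) \<in> borel_measurable borel"
  proof (rule borel_measurable_LIMSEQ_real)
    fix x
    have "(\<lambda>n. Im (G (Complex x (1 / Suc n))) / - pi) \<longlonglongrightarrow> - pi * \<rho> x / - pi" if "x \<notin> S"
      by (rule tendsto_divide[OF filterlim_compose[OF lim[OF that] fl] tendsto_const]) simp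
    then show "(\<lambda>n. if x \<in> S then 0 else Im (G (Complex x (1 / Suc n))) / - pi) \<longlonglongrightarrow> (if x \<in> S then 0 else \<rho> x)"
      by (cases "x \<in> S") simp_all
  next
    fix n
    have [measurable]: "S \<in> sets borel" by (rule sets.countable) (auto intro: countable_finite[OF S])
    have [measurable]: "(\<lambda>x. Im (G (Complex x (1 / Suc n)))) \<in> borel_measurable borel" by (rule meas) simp
    show "(\<lambda>x. if x \<in> S then 0 else Im (G (Complex x (1 / Suc n))) / - pi) \<in> borel_measurable borel"
      by measurable
  qed
  then show \<rho>_meas [measurable]: "\<rho> \<in> borel_measurable borel"
    by (rule measurable_discrete_difference[where X=S]) (auto intro: countable_finite[OF S])
  have "AE x in lborel. x \<notin> S" using S by (intro AE_not_in finite_imp_null_set_lborel)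
  then have lim_AE: "AE x in lborel. ((\<lambda>h. Im (G (Complex x h))) \<longlongrightarrow> - pi * \<rho> x) (at_right 0)"
    by eventually_elim (rule lim)
  obtain c where c: "0 < c" "\<And>x h. x \<noteq> 0 \<Longrightarrow> 0 < h \<Longrightarrow> h \<le> 1 \<Longrightarrow> \<bar>Im (G (Complex x h))\<bar> \<le> c * power_majorant x"
    by (rule G_majorant) blast
  have maj: "integrable lborel (\<lambda>x. c * power_majorant x)" using integrable_power_majorant by simp
  have \<rho>_int: "integrable lborel \<rho>"
  proof (rule Bochner_Integration.integrable_bound[of lborel "\<lambda>x. c * power_majorant x / pi"])
    show "integrable lborel (\<lambda>x. c * power_majorant x / pi)" using maj by simp
    have "AE x in lborel. x \<noteq> (0::real)" by (rule AE_lborel_singleton)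
    then show "AE x in lborel. norm (\<rho> x) \<le> norm (c * power_majorant x / pi)"
      using lim_AE
    proof eventually_elim
      case (elim x)
      have "\<forall>\<^sub>F h in at_right 0. \<bar>Im (G (Complex x h))\<bar> \<le> c * power_majorant x"
        by (rule eventually_at_rightI[of 0 1]) (use c(2)[OF elim(1)] in auto)
      then have "\<bar>- pi * \<rho> x\<bar> \<le> c * power_majorant x"
        by (rule tendsto_upperbound[OF tendsto_rabs[OF elim(2)]]) simp
      then have "\<bar>\<rho> x\<bar> \<le> c * power_majorant x / pi" by (simp add: abs_mult field_simps)
      then show ?case unfolding real_norm_def using abs_ge_self[of "c * power_majorant x / pi"] by linarith
    qed
  qed simp
  define R where "R = 4 * k + 4 * (b + 2 * a) + 1"
  have R: "4 * k \<le> cmod z" "4 * (b + 2 * a) \<le> cmod z" "1 \<le> cmod z" if "R \<le> cmod z" for z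
    using that k_pos a_pos b_nonneg unfolding R_def by simp_all
  have transform: "(LBINT x. \<rho> x *\<^sub>R (1 / (z - of_real x))) = G z" if z: "0 < Im z" for z
  proof -
    have "(LBINT x. of_real (- pi * \<rho> x) / (of_real x - z)) = of_real pi * G z"
    proof (rule stieltjes_from_boundary_values[OF holomorphic_G _ c(2) maj lim_AE _ z])
      show "cmod (G z) \<le> 4 / cmod z" if "0 < Im z" "R \<le> cmod z" for z
        using G_asymp(1)[OF that(1) R[OF that(2)]] .
    qed auto
    moreover have "of_real (- pi * \<rho> x) / (of_real x - z) = of_real pi * (\<rho> x *\<^sub>R (1 / (z - of_real x)))" for x
      using z by (cases "z = of_real x") (auto simp: field_simps scaleR_conv_of_real)
    ultimately have "(LBINT x. of_real pi * (\<rho> x *\<^sub>R (1 / (z - of_real x)))) = of_real pi * G z"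
      by (simp only:)
    then show ?thesis by (simp only: integral_mult_right_zero mult_cancel_left of_real_eq_0_iff pi_neq_zero simp_thms)
  qed
  show "stieltjes (density lborel (\<lambda>x. ennreal (\<rho> x))) z = G z" if "0 < Im z" for z
    unfolding stieltjes_def transform[OF that, symmetric] by (rule integral_density) (auto simp: nonneg)
  have "(LBINT x. \<rho> x) = 1"
  proof -
    \<comment> \<open>The total mass is the limit of y G(y) along the imaginary axis: |y| <= |y - x|
      permits dominated convergence, and \<open>G_asymp\<close> gives the value 1.\<close>
    define y where "y n = \<i> * of_real (real (Suc n))" for n
    have y: "0 < Im (y n)" "cmod (y n) = Suc n" for n by (simp_all add: y_def norm_mult del: of_nat_Suc)
    have "(\<lambda>n. LBINT x. \<rho> x *\<^sub>R (y n / (y n - of_real x))) \<longlonglongrightarrow> (LBINT x. of_real (\<rho> x))"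
    proof (rule integral_dominated_convergence[where w=\<rho>])
      show "AE x in lborel. (\<lambda>n. \<rho> x *\<^sub>R (y n / (y n - of_real x))) \<longlonglongrightarrow> of_real (\<rho> x)"
      proof (rule AE_I2)
        fix x
        have "(\<lambda>n. 1 / (1 - of_real x * (- \<i> * of_real (1 / real (Suc n))))) \<longlonglongrightarrow> 1 / (1 - of_real x * (- \<i> * of_real 0))"
          by (intro tendsto_intros LIMSEQ_Suc[OF lim_1_over_n]) auto
        moreover have "1 / (1 - of_real x * (- \<i> * of_real (1 / real (Suc n)))) = y n / (y n - of_real x)" for n
        proof -
          have "y n - of_real x = y n * (1 - of_real x * (- \<i> * of_real (1 / real (Suc n))))"
            by (simp add: y_def algebra_simps del: of_nat_Suc)
          moreover have "y n \<noteq> 0" using y(1)[of n] by auto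
          ultimately show ?thesis by simp
        qed
        ultimately have "(\<lambda>n. y n / (y n - of_real x)) \<longlonglongrightarrow> 1" by simp
        from tendsto_scaleR[OF tendsto_const this, of "\<rho> x"]
        show "(\<lambda>n. \<rho> x *\<^sub>R (y n / (y n - of_real x))) \<longlonglongrightarrow> of_real (\<rho> x)" by (simp add: scaleR_conv_of_real)
      qed
      show "AE x in lborel. norm (\<rho> x *\<^sub>R (y n / (y n - of_real x))) \<le> \<rho> x" for n
      proof (rule AE_I2)
        fix x
        have "cmod (y n) \<le> cmod (y n - of_real x)"
          using abs_Im_le_cmod[of "y n - of_real x"] y(2)[of n] by (simp add: y_def)
        then have "cmod (y n / (y n - of_real x)) \<le> 1" by (simp add: norm_divide divide_le_eq_1)
        then show "norm (\<rho> x *\<^sub>R (y n / (y n - of_real x))) \<le> \<rho> x"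
          using nonneg[of x] by (simp add: mult_left_le)
      qed
    qed (use \<rho>_int in auto)
    moreover have "(LBINT x. \<rho> x *\<^sub>R (y n / (y n - of_real x))) = y n * G (y n)" for n
      unfolding transform[OF y(1), symmetric] by (subst integral_mult_right_zero[symmetric]) simp
    ultimately have 1: "(\<lambda>n. y n * G (y n)) \<longlonglongrightarrow> (LBINT x. of_real (\<rho> x))" by simp
    have "(\<lambda>n. y n * G (y n) - 1) \<longlonglongrightarrow> 0"
    proof (rule Lim_null_comparison)
      obtain m where m: "R \<le> real m" using real_arch_simple by blast
      show "\<forall>\<^sub>F n in sequentially. norm (y n * G (y n) - 1) \<le> (16 * k + 4 * (b + 2 * a)) / Suc n"
        using eventually_ge_at_top[of m]
      proof eventually_elim
        case (elim n)
        have "R \<le> cmod (y n)" using m elim y(2)[of n] by simp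
        note * = G_asymp(2)[OF y(1) R[OF this]]
        have "y n \<noteq> 0" using y(1)[of n] by auto
        then have "y n * G (y n) - 1 = y n * (G (y n) - 1 / y n)" by (simp add: right_diff_distrib)
        then have "norm (y n * G (y n) - 1) \<le> Suc n * ((16 * k + 4 * (b + 2 * a)) / (real (Suc n))\<^sup>2)"
          using mult_left_mono[OF *, of "cmod (y n)"] unfolding y(2) by (simp add: norm_mult y(2))
        then show ?case by (simp add: power2_eq_square del: of_nat_Suc)
      qed
      show "(\<lambda>n. (16 * k + 4 * (b + 2 * a)) / Suc n) \<longlonglongrightarrow> 0"
        by (rule LIMSEQ_Suc[OF lim_const_over_n])
    qed
    then have "(\<lambda>n. y n * G (y n)) \<longlonglongrightarrow> 1" by (simp add: LIM_zero_iff)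
    then have "(LBINT x. complex_of_real (\<rho> x)) = 1" using 1 LIMSEQ_unique by blast
    then show ?thesis by (simp add: of_real_eq_1_iff)
  qed
  then have "emeasure (density lborel (\<lambda>x. ennreal (\<rho> x))) UNIV = 1"
    using nn_integral_eq_integral[OF \<rho>_int] nonneg by (simp add: emeasure_density)
  then show "real_distribution (density lborel (\<lambda>x. ennreal (\<rho> x)))"
    by (intro real_distribution.intro real_distribution_axioms.intro prob_spaceI) auto
qed

end

section \<open>The closed formula\<close>

text \<open>The principal power is the real cube root only on nonnegative reals; \<open>g_eq\<close>
  and \<open>H_pos\<close> place g there.\<close>

lemma ccbrt_of_real:
  assumes "0 \<le> x" shows "ccbrt (of_real x) = of_real (root 3 x)"
proof -
  have "ccbrt (of_real x) = of_real (x powr (1/3))"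
    using powr_of_real[OF assms, of "1/3"] by (simp add: ccbrt_def)
  also have "x powr (1/3) = root 3 x"
    using assms root_powr_inverse[of 3 x] by (cases "x = 0") auto
  finally show ?thesis .
qed

text \<open>Vieta's relations for the cubic at x, with roots w0 and p + iq, p - iq.\<close>

context
  fixes r t a x w0 p q N :: real
  assumes t: "0 < t" and a: "0 < a" and x: "0 < x" and rt: "r * t \<le> t" "0 < r * t"
    and w0: "w0 < 0" and q: "0 < q" and N: "N = p\<^sup>2 + q\<^sup>2"
    and V1: "t - r * t + x = x * (w0 + 2 * p)"
    and V2: "t - a = x * (N + 2 * w0 * p)"
    and V3: "a = - x * w0 * N"
begin

private lemma coeffs:
  "t = x * (N + 2 * w0 * p) - x * w0 * N"
  "r * t = x * (N + 2 * w0 * p) - x * w0 * N - x * (w0 + 2 * p) + x"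
  using V1 V2 V3 by argo+

private lemma p_pos: "0 < p"
proof -
  have "0 < x * (w0 + 2 * p)" unfolding V1[symmetric] using rt x by linarith
  then have "0 < w0 + 2 * p" using x by (simp add: zero_less_mult_iff)
  then show ?thesis using w0 by linarith
qed

text \<open>With w1 = p + i q, |w1 - w0|^2 = \<delta>^2 + q^2, so the discriminant is -4 q^2
  (\<delta>^2 + q^2)^2.\<close>

private definition "\<delta> = p - w0"

private lemma \<delta>_pos: "0 < \<delta>" using p_pos w0 by (simp add: \<delta>_def)

private lemma S_eq: "- 3 * MP_S r t a x = (2 * sqrt 3 * x\<^sup>2 * q * (\<delta>\<^sup>2 + q\<^sup>2))\<^sup>2"
proof -
  define k where "k = r * t"
  have "MP_S r t a x = 4*a*x^3 - (8*a^2 + 12*a*k + 8*a*t - t^2)*x^2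
     + 2*(2*a^3 - 10*a^2*k + 4*a^2*t + 6*a*k^2 - a*k*t + a*t^2 - k*t^2 - t^3)*x
     + (k-t)^2*(a^2 - 4*a*k + 2*a*t + t^2)"
    unfolding MP_S_def k_def by algebra
  also have "\<dots> = - 4 * x^4 * q\<^sup>2 * (\<delta>\<^sup>2 + q\<^sup>2)\<^sup>2"
    unfolding k_def coeffs(2) unfolding coeffs(1) unfolding V3 unfolding N \<delta>_def by algebra
  finally have "MP_S r t a x = - 4 * x^4 * q\<^sup>2 * (\<delta>\<^sup>2 + q\<^sup>2)\<^sup>2" .
  moreover have "(2 * sqrt 3 * x\<^sup>2 * q * (\<delta>\<^sup>2 + q\<^sup>2))\<^sup>2 = 12 * (x\<^sup>2 * q * (\<delta>\<^sup>2 + q\<^sup>2))\<^sup>2"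
    by (simp add: power_mult_distrib)
  ultimately show ?thesis by algebra
qed

text \<open>Minus x times the Lagrange resolvent w0 + \<omega> w1 + \<omega>^2
  \<open>cnj w1\<close>, with w1 = p + i q and \<omega> = exp (2 pi i/3): the cube root in Cardano's
  formula up to scaling.\<close>

private definition "H = x * (\<delta> + sqrt 3 * q)"

private lemma H_pos: "0 < H" using x \<delta>_pos q by (simp add: H_def add_pos_pos)

private lemma g_eq: "MP_g r t a x = of_real (2 * H^3)"
proof -
  define k where "k = r * t"
  have sq: "csqrt (of_real (- 3 * MP_S r t a x)) = of_real (2 * sqrt 3 * x\<^sup>2 * q * (\<delta>\<^sup>2 + q\<^sup>2))"
    unfolding S_eq using x q by (subst csqrt_of_real_nonneg) (auto simp: real_sqrt_abs abs_mult)
  have "-2*x^3 + 3*((2*r+1)*t + 6*a)*x^2 - 3*(r-1)*((2*r+1)*t - 3*a)*t*x + 2*(r-1)^3*t^3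
     = -2*x^3 + 3*(2*k + t + 6*a)*x^2 - 3*(k-t)*(2*k + t - 3*a)*x + 2*(k-t)^3"
    unfolding k_def by algebra
  also have "\<dots> = 2 * x^3 * (\<delta>^3 + 9 * \<delta> * q\<^sup>2)"
    unfolding k_def coeffs(2) unfolding coeffs(1) unfolding V3 unfolding N \<delta>_def by algebra
  finally have P: "-2*x^3 + 3*((2*r+1)*t + 6*a)*x^2 - 3*(r-1)*((2*r+1)*t - 3*a)*t*x + 2*(r-1)^3*t^3
     = 2 * x^3 * (\<delta>^3 + 9 * \<delta> * q\<^sup>2)" .
  define s where "s = sqrt 3"
  have s3: "s * s = 3" by (simp add: s_def)
  have "2 * x^3 * (\<delta>^3 + 9 * \<delta> * q\<^sup>2) + 3 * x * (2 * sqrt 3 * x\<^sup>2 * q * (\<delta>\<^sup>2 + q\<^sup>2)) = 2 * H^3"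
  proof -
    have "(\<delta> + s * q)^3 = \<delta>^3 + 3 * s * q * \<delta>\<^sup>2 + 3 * (s * s) * \<delta> * q\<^sup>2 + (s * s) * s * q^3" by algebra
    then show ?thesis unfolding H_def s_def[symmetric] power_mult_distrib s3 by algebra
  qed
  then show ?thesis unfolding MP_g_def P sq by (simp only: of_real_add of_real_mult of_real_numeral flip: \<open>_ = 2 * H^3\<close>)
qed

text \<open>The quadratic in the numerator of \<phi> is the product of H and the conjugate resolvent
  x (\<delta> - sqrt 3 q). In the sum of the two the terms with sqrt 3 cancel.\<close>

private lemma phi_eq: "MP_phi r t a x = of_real (- 2 * x * p)"
proof -
  define k c where "k = r * t" and "c = root 3 2"
  have c: "0 < c" "c^3 = 2" by (simp_all add: c_def)
  have "2 * H^3 = (c * H)^3" using c by (simp add: power_mult_distrib)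
  then have g3: "ccbrt (MP_g r t a x) = of_real (c * H)"
    unfolding g_eq using H_pos c by (subst ccbrt_of_real) (auto simp: real_root_power_cancel simp del: power_mult_distrib)
  have A: "x^2 + (3*a - (2*r+1)*t)*x + t^2*(r-1)^2 = H * (x * (\<delta> - sqrt 3 * q))"
  proof -
    have "x^2 + (3*a - (2*r+1)*t)*x + t^2*(r-1)^2 = x^2 + (3*a - 2*k - t)*x + (k-t)^2"
      unfolding k_def by algebra
    also have "\<dots> = x\<^sup>2 * (\<delta>\<^sup>2 - 3 * q\<^sup>2)"
      unfolding k_def coeffs(2) unfolding coeffs(1) unfolding V3 unfolding N \<delta>_def by algebra
    finally show ?thesis unfolding H_def by (simp add: power2_eq_square algebra_simps)
  qed
  have "- (2/3) * (x - (r-1)*t) - (c/3) * (H * (x * (\<delta> - sqrt 3 * q))) / (c * H) - (c * H) / (3 * c) = - 2 * x * p"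
  proof -
    have "(c/3) * (H * (x * (\<delta> - sqrt 3 * q))) / (c * H) = x * (\<delta> - sqrt 3 * q) / 3"
      using c H_pos by simp
    moreover have "(c * H) / (3 * c) = H / 3" using c by simp
    moreover have "x - (r-1)*t = x * (w0 + 2 * p)" using V1 by (simp add: algebra_simps)
    ultimately show ?thesis unfolding H_def \<delta>_def by (simp add: algebra_simps)
  qed
  then show ?thesis unfolding MP_phi_def Let_def g3 A c_def[symmetric]
    by (simp only: of_real_diff of_real_divide of_real_mult of_real_numeral flip: \<open>_ = - 2 * x * p\<close>)
qed

text \<open>Since \<phi> = -2 x p < 0, \<open>d-\<close> and \<open>d+\<close> are conjugate, equal
  to (u - i v)^2 and (u + i v)^2. With w1 = p + i q this gives u = sqrt x |w1| and d0 = x |1 -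
  w1|^2.\<close>

lemma MP_formula_of_root: "MP_formula r t a x = of_real (q / (pi * (r * t)))"
proof -
  define U u s where "U = x * N" and "u = sqrt U" and "s = sqrt (a * (2 * x * p))"
  have N0: "0 < N" unfolding N using q by (simp add: add_nonneg_pos)
  have U: "0 < U" "0 < u" "u\<^sup>2 = U" using x N0 by (auto simp: U_def u_def)
  have s: "0 < s" "s\<^sup>2 = a * (2 * x * p)" using a x p_pos by (auto simp: s_def)
  define v where "v = s / u"
  have v: "u * v = s" "0 < v" using U s by (auto simp: v_def)
  \<comment> \<open>This identity makes v^2 = U - (t - a), so that t - a = u^2 - v^2 and s = u v
    complete the squares.\<close>
  have Us: "U * (U - (t - a)) = s\<^sup>2" unfolding s V2 U_def using V3 by algebra
  have "U * v\<^sup>2 = s\<^sup>2" unfolding U(3)[symmetric] v(1)[symmetric] by (simp add: power_mult_distrib)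
  with Us have "U * v\<^sup>2 = U * (U - (t - a))" by simp
  then have v2: "v\<^sup>2 = U - (t - a)" using U by simp
  have sq: "csqrt (of_real a * MP_phi r t a x) = \<i> * of_real s"
  proof -
    have "of_real a * MP_phi r t a x = of_real (- (a * (2 * x * p)))" unfolding phi_eq by simp
    moreover have "0 < a * (2 * x * p)" using a x p_pos by simp
    ultimately show ?thesis unfolding s_def by (simp only: csqrt_of_real_nonpos) simp
  qed
  have dm: "MP_dm r t a x = (Complex u (- v))\<^sup>2" and dp: "MP_dp r t a x = (Complex u v)\<^sup>2"
    unfolding MP_dm_def MP_dp_def sq using U(3) v2 v(1)
    by (auto simp: complex_eq_iff power2_eq_square algebra_simps)
  have cdm: "csqrt (MP_dm r t a x) = Complex u (- v)" and cdp: "csqrt (MP_dp r t a x) = Complex u v"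
    unfolding dm dp using U by (auto intro!: csqrt_unique)
  have half: "(csqrt (MP_dm r t a x) + csqrt (MP_dp r t a x)) / 2 = of_real u"
    unfolding cdm cdp by (simp add: complex_eq_iff)
  have "MP_dm r t a x * MP_dp r t a x = of_real ((u\<^sup>2 + v\<^sup>2)\<^sup>2)"
    unfolding dm dp by (simp add: complex_eq_iff power2_eq_square algebra_simps)
  then have prod: "csqrt (MP_dm r t a x * MP_dp r t a x) = of_real (u\<^sup>2 + v\<^sup>2)"
    by (simp only:) (subst csqrt_of_real_nonneg, auto)
  define V where "V = x * ((1 - p)\<^sup>2 + q\<^sup>2)"
  have V: "0 < V" using x q by (auto simp: V_def intro!: mult_pos_pos add_nonneg_pos)
  have VU: "V = - 2 * x * p + x + U" unfolding V_def U_def N by (simp add: power2_eq_square algebra_simps)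
  have d0: "MP_d0 r t a x = of_real V"
  proof -
    have "V = - 2 * x * p + (x + (t - a) / 2) + (u\<^sup>2 + v\<^sup>2) / 2" unfolding v2 U(3) VU by (simp add: field_simps)
    then show ?thesis unfolding MP_d0_def phi_eq prod by simp
  qed
  have sV: "csqrt (MP_d0 r t a x) = of_real (sqrt V)" unfolding d0 using V by (simp add: csqrt_of_real_nonneg)
  \<comment> \<open>Heron's formula: the left side is 16 times the squared area of a triangle with
    sides sqrt x, u, sqrt V. This is the triangle 0, 1, p + i q scaled by sqrt x, of area x
    q/2.\<close>
  have "(x - (u - sqrt V)\<^sup>2) * ((u + sqrt V)\<^sup>2 - x) = (2 * x * q)\<^sup>2"
  proof -
    define y where "y = sqrt V"
    have y: "y\<^sup>2 = V" using V by (simp add: y_def)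
    have "(x - (u - y)\<^sup>2) * ((u + y)\<^sup>2 - x) = - (x\<^sup>2 - 2 * (u\<^sup>2 + y\<^sup>2) * x + (u\<^sup>2 - y\<^sup>2)\<^sup>2)" by algebra
    also have "\<dots> = (2 * x * q)\<^sup>2" unfolding y U(3) VU unfolding U_def N by algebra
    finally show ?thesis by (simp add: y_def)
  qed
  then have "(of_real x - MP_fL r t a x) * (MP_fR r t a x - of_real x) = of_real ((2 * x * q)\<^sup>2)"
    unfolding MP_fL_def MP_fR_def half sV by (simp only: of_real_add of_real_diff of_real_mult of_real_power flip: \<open>_ = (2 * x * q)\<^sup>2\<close>)
  then have "MP_formula r t a x = of_real (2 * x * q) / of_real (2 * pi * r * x * t)"
    unfolding MP_formula_def using x q by (simp only:) (subst csqrt_of_real_nonneg, auto)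
  then show ?thesis using x by (simp add: mult_ac)
qed

end

section \<open>Zeros of S and the density\<close>

text \<open>Vieta for S. The constant term contains (a - t)^2 + 4 a t (1 - r) >= 0, so the product
  of the roots is at most 0. Were x2 < 0, all roots would be nonpositive; their sum then forces 8 a
  < t, which contradicts the positive linear coefficient.\<close>

lemma MP_S_roots_sign:
  fixes r t a x1 x2 x3 :: real
  assumes r: "0 < r" "r \<le> 1" and t: "0 < t" and a: "0 \<le> a"
    and roots: "\<And>x. MP_S r t a x = 4*a*(x - x1)*(x - x2)*(x - x3)"
    and ord: "x1 \<le> x2" "x2 \<le> x3"
  shows "0 < a" "x1 \<le> 0" "0 \<le> x2"
proof -
  define c2 c1 c0 e1 e2 e3 where c: "c2 = 8*a^2 + 4*a*(3*r+2)*t - t^2"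
    "c1 = 2*a^3 - 2*a^2*(5*r-2)*t + a*(r*(6*r-1)+1)*t^2 - (r+1)*t^3"
    "c0 = (r-1)^2*t^2*(a^2 - a*(4*r-2)*t + t^2)"
    and e: "e1 = 4 * a * (x1 + x2 + x3)" "e2 = 2 * a * (x1*x2 + x3*(x1+x2))" "e3 = 4 * a * (x1 * x2 * x3)"
  have expand: "4*a*x^3 - c2*x^2 + 2*c1*x + c0 = 4*a*x^3 - e1*x^2 + 2*e2*x - e3" for x
  proof -
    have "4*a*x^3 - c2*x^2 + 2*c1*x + c0 = MP_S r t a x" by (simp add: MP_S_def c)
    also have "\<dots> = 4*a*x^3 - e1*x^2 + 2*e2*x - e3" unfolding roots e by algebra
    finally show ?thesis .
  qed
  have "c2 = e1" "c1 = e2" "c0 = - e3"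
    using expand[of 1] expand[of "-1"] expand[of 0] by simp_all
  then have sum: "8*a^2 + 4*a*(3*r+2)*t - t^2 = 4 * a * (x1 + x2 + x3)"
    and pairs: "2*a^3 - 2*a^2*(5*r-2)*t + a*(r*(6*r-1)+1)*t^2 - (r+1)*t^3 = 2 * a * (x1*x2 + x3*(x1+x2))"
    and "(r-1)^2*t^2*(a^2 - a*(4*r-2)*t + t^2) = - (4 * a * (x1 * x2 * x3))"
    unfolding c e by simp_all
  moreover have "a^2 - a*(4*r-2)*t + t^2 = (a - t)^2 + 4*a*t*(1-r)" by algebra
  ultimately have prod: "(r-1)^2*t^2*((a - t)^2 + 4*a*t*(1-r)) = - (4 * a * (x1 * x2 * x3))" by (simp only:)
  show a0: "0 < a"
  proof (rule ccontr)
    assume "\<not> 0 < a"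
    then have "a = 0" using a by simp
    then show False using sum t by simp
  qed
  have "0 \<le> (r-1)^2*t^2*((a - t)^2 + 4*a*t*(1-r))" using a t r by simp
  then have "a * (x1 * x2 * x3) \<le> 0" unfolding prod by simp
  then have prod_le: "x1 * x2 * x3 \<le> 0" using a0 by (simp add: mult_le_0_iff)
  show "x1 \<le> 0"
  proof (rule ccontr)
    assume "\<not> x1 \<le> 0"
    then have "0 < x1 * x2 * x3" using ord by (intro mult_pos_pos) auto
    then show False using prod_le by simp
  qed
  show "0 \<le> x2"
  proof (rule ccontr)
    assume "\<not> 0 \<le> x2"
    then have neg: "x1 < 0" "x2 < 0" using ord by auto
    then have x12: "0 < x1 * x2" by (simp add: mult_neg_neg)
    then have x3: "x3 \<le> 0" using prod_le mult_pos_pos[of "x1 * x2" x3] by linarith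
    have "a * (x1 + x2 + x3) < 0" using neg x3 a0 by (simp add: mult_pos_neg)
    moreover have "0 \<le> 8 * a\<^sup>2 + 12 * (a * r * t)" using a0 r t by simp
    ultimately have "8 * a * t < t * t" using sum by (simp add: power2_eq_square algebra_simps)
    then have at: "8 * a < t" using t by simp
    have "0 \<le> x3 * (x1 + x2)" using neg x3 by (simp add: mult_nonpos_nonpos)
    then have "0 < a * (x1*x2 + x3*(x1+x2))" using a0 x12 by (simp add: add_pos_nonneg)
    then have pos: "0 < 2*a^3 - 2*a^2*(5*r-2)*t + a*(r*(6*r-1)+1)*t^2 - (r+1)*t^3" unfolding pairs by simp
    have "a^2 \<le> a * (t/8)" using at a0 by (simp add: power2_eq_square)
    moreover have "a * (t/8) \<le> t^2 / 64" using at t by (simp add: power2_eq_square)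
    ultimately have a2: "a^2 \<le> t^2 / 64" by linarith
    have "2*a^3 \<le> t^3/64"
    proof -
      have "a * a^2 \<le> (t/8) * (t^2/64)" using a2 at a0 by (intro mult_mono) auto
      moreover have "0 \<le> t^3" using t by simp
      ultimately show ?thesis by (simp add: power2_eq_square power3_eq_cube)
    qed
    moreover have "- 2*a^2*(5*r-2)*t \<le> t^3/16"
    proof -
      have "a^2 * (4 - 10*r) \<le> a^2 * 4" using r by (intro mult_left_mono) auto
      then have "a^2 * (4 - 10*r) \<le> t^2/64 * 4" using a2 by linarith
      then have "a^2 * (4 - 10*r) * t \<le> t^2/64 * 4 * t" using t by (intro mult_right_mono) auto
      then show ?thesis by (simp add: power2_eq_square power3_eq_cube algebra_simps)
    qed
    moreover have "a*(r*(6*r-1)+1)*t^2 \<le> (5*r+1)*t^3/8"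
    proof -
      have "r * r \<le> r" using r by (simp add: mult_left_le)
      then have "r*(6*r-1)+1 \<le> 5*r+1" by (simp add: algebra_simps)
      moreover have "0 \<le> 5 * r + 1" using r by simp
      ultimately have "a*(r*(6*r-1)+1) \<le> (t/8)*(5*r+1)"
        using at a0 t mult_left_mono[of "r*(6*r-1)+1" "5*r+1" a] mult_right_mono[of a "t/8" "5*r+1"] by linarith
      then have "a*(r*(6*r-1)+1)*t^2 \<le> (t/8)*(5*r+1)*t^2" by (intro mult_right_mono) auto
      then show ?thesis by (simp add: power2_eq_square power3_eq_cube algebra_simps)
    qed
    \<comment> \<open>The three bounds from 8 a < t add up to at most (r+1) t^3, the negative part
      of the linear coefficient.\<close>
    moreover have "t^3/64 + t^3/16 + (5*r+1)*t^3/8 \<le> (r+1)*t^3"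
    proof -
      have "1/64 + 1/16 + (5*r+1)/8 \<le> r + 1" using r by argo
      then have "(1/64 + 1/16 + (5*r+1)/8) * t^3 \<le> (r+1)*t^3" using t by (intro mult_right_mono) auto
      then show ?thesis by (simp add: algebra_simps)
    qed
    ultimately show False using pos by (simp add: algebra_simps)
  qed
qed

theorem theorem1p1:
  fixes r t a x1 x2 x3 :: real
  assumes r: "0 < r" "r \<le> 1"
    and t: "0 < t"
    and a: "0 \<le> a"
    and roots: "\<And>x. MP_S r t a x = 4*a*(x - x1)*(x - x2)*(x - x3)"
    and ord: "x1 \<le> x2" "x2 \<le> x3"
  shows "\<exists>\<rho> :: real \<Rightarrow> real.
           (\<forall>x. x2 < x \<and> x < x3 \<longrightarrow> complex_of_real (\<rho> x) = MP_formula r t a x) \<and>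
           (\<forall>x. \<not> (x2 < x \<and> x < x3) \<longrightarrow> \<rho> x = 0) \<and>
           is_MP_measure r t a (density lborel (\<lambda>x. ennreal (\<rho> x))) \<and>
           (\<forall>\<mu>. is_MP_measure r t a \<mu> \<longrightarrow> \<mu> = density lborel (\<lambda>x. ennreal (\<rho> x)))"
proof -
  note a0 = MP_S_roots_sign(1)[OF r t a roots ord] and x10 = MP_S_roots_sign(2)[OF r t a roots ord]
    and x20 = MP_S_roots_sign(3)[OF r t a roots ord]
  define k b where "k = r * t" and "b = t - r * t"
  have k0: "0 < k" using r t by (simp add: k_def)
  have b0: "0 \<le> b" using r t by (simp add: b_def mult_left_le_one_le)
  have bk: "b + k = t" by (simp add: b_def k_def)
  interpret self_energy k b a by unfold_locales fact+
  have disc: "disc x = MP_S r t a x" for x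
    unfolding disc_def MP_S_def Let_def bk unfolding b_def k_def by algebra
  have disc_roots: "disc x = 4*a*(x - x1)*(x - x2)*(x - x3)" for x unfolding disc roots ..
  \<comment> \<open>The formula is complex valued; that it is real on the interval is part of
    \<open>inside\<close>.\<close>
  define \<rho> where "\<rho> x = (if x2 < x \<and> x < x3 then Re (MP_formula r t a x) else 0)" for x
  have inside: "0 < \<rho> x \<and> complex_of_real (\<rho> x) = MP_formula r t a x \<and>
      ((\<lambda>h. Im (G (Complex x h))) \<longlongrightarrow> - pi * \<rho> x) (at_right 0)" if x: "x2 < x" "x < x3" for x
  proof -
    have x0: "0 < x" using x x20 by linarith
    have "disc x < 0" unfolding disc_roots using x x0 x10 a0
      by (intro mult_pos_neg mult_pos_pos) auto
    then obtain w0 p q where w0: "w0 < 0" and q: "0 < q"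
      and V: "b + x = x * (w0 + 2 * p)" "b + k - a = x * (p\<^sup>2 + q\<^sup>2 + 2 * w0 * p)" "a = - x * w0 * (p\<^sup>2 + q\<^sup>2)"
      and lim: "((\<lambda>h. Im (W (Complex x h))) \<longlongrightarrow> q) (at_right 0)"
      by (rule boundary_disc_neg[OF x0])
    have formula: "MP_formula r t a x = of_real (q / (pi * (r * t)))"
      by (rule MP_formula_of_root[where p=p, OF t a0 x0 _ _ w0 q refl])
        (use V b0 k0 in \<open>simp_all add: b_def k_def\<close>)
    then have \<rho>: "\<rho> x = q / (pi * k)" using x by (simp add: \<rho>_def k_def)
    have "((\<lambda>h. - Im (W (Complex x h)) / k) \<longlongrightarrow> - q / k) (at_right 0)"
      using lim k0 by (intro tendsto_divide tendsto_minus tendsto_const) auto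
    also have "- q / k = - pi * \<rho> x" by (simp add: \<rho>)
    finally have "((\<lambda>h. Im (G (Complex x h))) \<longlongrightarrow> - pi * \<rho> x) (at_right 0)" unfolding Im_G .
    moreover have "complex_of_real (\<rho> x) = MP_formula r t a x" unfolding formula \<rho> k_def ..
    ultimately show ?thesis using q k0 by (simp add: \<rho>)
  qed
  have nonneg: "0 \<le> \<rho> x" for x
    using inside[of x] by (cases "x2 < x \<and> x < x3") (auto simp: \<rho>_def)
  \<comment> \<open>Outside these points x is nonzero and the discriminant does not vanish.\<close>
  define S where "S = {0, x1, x2, x3}"
  have lim: "((\<lambda>h. Im (G (Complex x h))) \<longlongrightarrow> - pi * \<rho> x) (at_right 0)" if xS: "x \<notin> S" for x
  proof (cases "x2 < x \<and> x < x3")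
    case False
    then have \<rho>: "\<rho> x = 0" by (simp only: \<rho>_def if_False)
    have "((\<lambda>h. Im (W (Complex x h))) \<longlongrightarrow> 0) (at_right 0)"
    proof (cases "x < 0")
      case True
      then show ?thesis by (rule boundary_neg)
    next
      case neg: False
      then have x0: "0 < x" using xS by (simp add: S_def)
      have "0 < (x - x2) * (x - x3)"
        using False xS ord by (cases "x < x2") (auto simp: S_def mult_neg_neg)
      moreover have "0 < 4 * a * (x - x1)" using a0 x0 x10 by simp
      ultimately have "0 < 4 * a * (x - x1) * ((x - x2) * (x - x3))" by (simp only: mult_pos_pos)
      then have "0 < disc x" unfolding disc_roots by (simp add: mult.assoc)
      then show ?thesis by (rule boundary_disc_pos[OF x0])
    qed
    then have "((\<lambda>h. - Im (W (Complex x h)) / k) \<longlongrightarrow> - 0 / k) (at_right 0)"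
      using k0 by (intro tendsto_divide tendsto_minus tendsto_const) auto
    then show ?thesis by (simp add: \<rho> Im_G)
  qed (use inside in blast)
  have "finite S" by (simp add: S_def)
  note boundary_density[OF this nonneg lim]
  then have meas: "\<rho> \<in> borel_measurable borel" and M: "real_distribution (density lborel (\<lambda>x. ennreal (\<rho> x)))"
    and transform: "\<And>z. 0 < Im z \<Longrightarrow> stieltjes (density lborel (\<lambda>x. ennreal (\<rho> x))) z = G z"
    by blast+
  let ?M = "density lborel (\<lambda>x. ennreal (\<rho> x))"
  \<comment> \<open>Transfers the equation from the upper to the lower half plane.\<close>
  have cnj: "stieltjes ?M (cnj z) = cnj (stieltjes ?M z)" for z
    unfolding stieltjes_def Bochner_Integration.integral_cnj[symmetric] by simp
  have MP: "is_MP_measure r t a ?M"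
    unfolding is_MP_measure_def Let_def
  proof (intro conjI allI impI)
    show "prob_space ?M" using M by (simp add: real_distribution_def)
    show "sets ?M = sets borel" by simp
    have "emeasure ?M {..<0} = (\<integral>\<^sup>+x. ennreal (\<rho> x) * indicator {..<0} x \<partial>lborel)"
      using meas by (simp add: emeasure_density)
    also have "(\<lambda>x. ennreal (\<rho> x) * indicator {..<0} x) = (\<lambda>x. 0)"
      using x20 by (auto simp: fun_eq_iff \<rho>_def indicator_def)
    finally show "emeasure ?M {..<0} = 0" by simp
    have upper: "z = 1 / stieltjes ?M z + of_real t / (1 - of_real (r * t) * stieltjes ?M z)
        + of_real a / (1 - of_real (r * t) * stieltjes ?M z)\<^sup>2" if z: "0 < Im z" for z
      using G_equation[OF z] unfolding transform[OF z] W_eq_G bk unfolding k_def .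
    fix z :: complex assume z: "Im z \<noteq> 0"
    show "z = 1 / stieltjes ?M z + of_real t / (1 - of_real (r * t) * stieltjes ?M z)
        + of_real a / (1 - of_real (r * t) * stieltjes ?M z)\<^sup>2"
    proof (cases "0 < Im z")
      case False
      then have "0 < Im (cnj z)" using z by simp
      from arg_cong[OF upper[OF this], of cnj] show ?thesis by (simp add: cnj)
    qed (rule upper)
  qed
  have "\<mu> = ?M" if \<mu>: "is_MP_measure r t a \<mu>" for \<mu>
  proof (rule stieltjes_injective[OF _ M])
    have sets: "sets \<mu> = sets borel" and prob: "prob_space \<mu>" and neg: "emeasure \<mu> {..<0} = 0"
      using \<mu> by (auto simp: is_MP_measure_def)
    show dist: "real_distribution \<mu>"
      using sets prob sets_eq_imp_space_eq[OF sets]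
      by (auto simp: real_distribution_def real_distribution_axioms_def)
    have AE: "AE y in \<mu>. 0 \<le> y"
      by (rule AE_I[where N="{..<0}"]) (use neg sets in auto)
    fix z :: complex assume z: "0 < Im z"
    have "let g = stieltjes \<mu> z; w = 1 - of_real k * g in z = 1 / g + of_real (b + k) / w + of_real a / w\<^sup>2"
      using \<mu> z unfolding bk is_MP_measure_def unfolding k_def by force
    then have "stieltjes \<mu> z = G z" by (rule stieltjes_transform_sol[OF dist AE z])
    then show "stieltjes \<mu> z = stieltjes ?M z" by (simp add: transform[OF z])
  qed
  moreover have "\<rho> x = 0" if "\<not> (x2 < x \<and> x < x3)" for x
    using that by (simp only: \<rho>_def if_False)
  ultimately show ?thesis using inside MP by blast
qed

end
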